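(* Let $k$ be a field containing a primitive $n$-th root of unity, let ${}_jE_i\in M_n(k)$ be the matrix whose only non-zero entry is a $1$ in position $(j,i)$, and let $F_{n-1}$ be the free group on $n-1$ generators $s_1,\dots,s_{n-1}$. Then the connected $F_{n-1}$-grading of the algebra $M_n(k)$ in which all ${}_jE_i$ are homogeneous, with $\deg({}_iE_i)=1$ for $1\le i\le n$, $\deg({}_{i+1}E_i)=s_i$ and $\deg({}_iE_{i+1})=s_i^{-1}$ for $1\le i\le n-1$, is simply connected.
   Context: The degree of an arbitrary ${}_jE_i$ is determined by multiplicativity: ${}_jE_i$ has degree $s_{j-1}\cdots s_{i+1}s_i$ for $j>i$, and ${}_iE_j$ has the inverse degree. A $k$-category is a small category $\mathcal B$ whose morphism sets ${}_y\mathcal B_x$ (from $x$ to $y$) are $k$-vector spaces with $k$-bilinear composition; a $k$-algebra is viewed as a $k$-category with one object. A grading $X$ of $\mathcal B$ by a group $\Gamma$ is a decomposition ${}_y\mathcal B_x=\bigoplus_{s\in\Gamma}X^s({}_y\mathcal B_x)$ with $X^t({}_z\mathcal B_y)X^s({}_y\mathcal B_x)\subset X^{ts}({}_z\mathcal B_x)$. A non-zero walk is a finite composable sequence $(f_n,\epsilon_n)\cdots(f_1,\epsilon_1)$ of non-zero morphisms with signs $\epsilon_i=\pm1$ (sign $-1$ exchanges source and target); if all $f_i$ are homogeneous its degree is $(\deg f_n)^{\epsilon_n}\cdots(\deg f_1)^{\epsilon_1}$. $\mathcal B$ is connected if any two objects are joined by a non-zero walk; the grading is connected if any two objects can be joined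 by a non-zero homogeneous walk of any prescribed degree in $\Gamma$ (for an algebra this means that the support $\{s\in\Gamma: X^sA\ne0\}$ generates $\Gamma$). The smash product category $\mathcal B\#\Gamma$ has objects $\mathcal B_0\times\Gamma$; the morphisms from $(b,g)$ to $(c,h)$ are $X^{h^{-1}g}({}_c\mathcal B_b)$; composition is that of $\mathcal B$. A connected $k$-category is simply connected if its only connected grading is the trivial grading (i.e. the one by the trivial group). A connected grading of $\mathcal B$ by $\Gamma$ is simply connected if the corresponding Galois covering $\mathcal B\#\Gamma\to\mathcal B$ is simply connected, i.e. the $k$-category $\mathcal B\#\Gamma$ is simply connected. *)

theory Defs
  imports "Jordan_Normal_Form.VS_Connect" "HOL-Algebra.Group"
begin

section \<open>Categories over a field\<close>

text \<open>\<open>Hom B x y\<close> is the vector space of morphisms from \<open>x\<close> to \<open>y\<close>, written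
  \<open>y\<close>-\<open>B\<close>-\<open>x\<close> (target first) in the literature.  Different morphism spaces need not be disjoint,
  so \<open>Comp B x y z g f\<close>, the composite of \<open>f\<close> from \<open>x\<close> to \<open>y\<close> with \<open>g\<close> from \<open>y\<close> to \<open>z\<close>, carries the
  objects.  Only the additive and scalar part of the module record is used; its \<open>mult\<close> and \<open>one\<close>
  are irrelevant, as in \<open>vectorspace\<close>.\<close>

record ('o, 'm, 'k) kcat =
  Obj :: "'o set"
  Hom :: "'o \<Rightarrow> 'o \<Rightarrow> ('k, 'm) module"
  Comp :: "'o \<Rightarrow> 'o \<Rightarrow> 'o \<Rightarrow> 'm \<Rightarrow> 'm \<Rightarrow> 'm"
  Id :: "'o \<Rightarrow> 'm"

locale k_category =
  fixes B :: "('o, 'm, 'k::field) kcat"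
  assumes hom_vectorspace:
      "\<lbrakk>x \<in> Obj B; y \<in> Obj B\<rbrakk> \<Longrightarrow> vectorspace class_ring (Hom B x y)"
    and comp_closed:
      "\<lbrakk>x \<in> Obj B; y \<in> Obj B; z \<in> Obj B; f \<in> carrier (Hom B x y); g \<in> carrier (Hom B y z)\<rbrakk>
        \<Longrightarrow> Comp B x y z g f \<in> carrier (Hom B x z)"
    and comp_add_left:
      "\<lbrakk>x \<in> Obj B; y \<in> Obj B; z \<in> Obj B; f \<in> carrier (Hom B x y);
        g \<in> carrier (Hom B y z); g' \<in> carrier (Hom B y z)\<rbrakk>
        \<Longrightarrow> Comp B x y z (g \<oplus>\<^bsub>Hom B y z\<^esub> g') f
            = Comp B x y z g f \<oplus>\<^bsub>Hom B x z\<^esub> Comp B x y z g' f"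
    and comp_add_right:
      "\<lbrakk>x \<in> Obj B; y \<in> Obj B; z \<in> Obj B; f \<in> carrier (Hom B x y);
        f' \<in> carrier (Hom B x y); g \<in> carrier (Hom B y z)\<rbrakk>
        \<Longrightarrow> Comp B x y z g (f \<oplus>\<^bsub>Hom B x y\<^esub> f')
            = Comp B x y z g f \<oplus>\<^bsub>Hom B x z\<^esub> Comp B x y z g f'"
    and comp_smult_left:
      "\<lbrakk>x \<in> Obj B; y \<in> Obj B; z \<in> Obj B; f \<in> carrier (Hom B x y); g \<in> carrier (Hom B y z)\<rbrakk>
        \<Longrightarrow> Comp B x y z (a \<odot>\<^bsub>Hom B y z\<^esub> g) f = a \<odot>\<^bsub>Hom B x z\<^esub> Comp B x y z g f"
    and comp_smult_right:
      "\<lbrakk>x \<in> Obj B; y \<in> Obj B; z \<in> Obj B; f \<in> carrier (Hom B x y); g \<in> carrier (Hom B y z)\<rbrakk>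
        \<Longrightarrow> Comp B x y z g (a \<odot>\<^bsub>Hom B x y\<^esub> f) = a \<odot>\<^bsub>Hom B x z\<^esub> Comp B x y z g f"
    and comp_assoc:
      "\<lbrakk>w \<in> Obj B; x \<in> Obj B; y \<in> Obj B; z \<in> Obj B;
        f \<in> carrier (Hom B w x); g \<in> carrier (Hom B x y); h \<in> carrier (Hom B y z)\<rbrakk>
        \<Longrightarrow> Comp B w x z (Comp B x y z h g) f = Comp B w y z h (Comp B w x y g f)"
    and id_closed: "x \<in> Obj B \<Longrightarrow> Id B x \<in> carrier (Hom B x x)"
    and id_left:
      "\<lbrakk>x \<in> Obj B; y \<in> Obj B; f \<in> carrier (Hom B x y)\<rbrakk> \<Longrightarrow> Comp B x y y (Id B y) f = f"
    and id_right:
      "\<lbrakk>x \<in> Obj B; y \<in> Obj B; f \<in> carrier (Hom B x y)\<rbrakk> \<Longrightarrow> Comp B x x y f (Id B x) = f"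

text \<open>A \<open>k\<close>-algebra, given as a module record with its multiplication and unit, as a category with
  one object.\<close>

definition one_object_kcat :: "('k, 'm) module \<Rightarrow> (unit, 'm, 'k) kcat" where
  "one_object_kcat A =
    \<lparr>Obj = {()}, Hom = (\<lambda>x y. A), Comp = (\<lambda>x y z g f. g \<otimes>\<^bsub>A\<^esub> f), Id = (\<lambda>x. \<one>\<^bsub>A\<^esub>)\<rparr>"


section \<open>Gradings\<close>

text \<open>Every vector is uniquely a sum of a finitely supported family of components; the last
  condition on \<open>c\<close> off \<open>S\<close> only makes the family unique as a total function.\<close>

definition internal_direct_sum :: "('k::field, 'm) module \<Rightarrow> 's set \<Rightarrow> ('s \<Rightarrow> 'm set) \<Rightarrow> bool" where
  "internal_direct_sum V S W \<longleftrightarrow>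
     (\<forall>s\<in>S. subspace class_ring (W s) V) \<and>
     (\<forall>v\<in>carrier V. \<exists>!c. finite {s. c s \<noteq> \<zero>\<^bsub>V\<^esub>} \<and>
        v = (\<Oplus>\<^bsub>V\<^esub>s\<in>{s. c s \<noteq> \<zero>\<^bsub>V\<^esub>}. c s) \<and>
        (\<forall>s\<in>S. c s \<in> W s) \<and> (\<forall>s. s \<notin> S \<longrightarrow> c s = \<zero>\<^bsub>V\<^esub>))"

text \<open>\<open>X s x y\<close> is the component of degree \<open>s\<close> of \<open>Hom B x y\<close>.\<close>

definition is_grading ::
  "'g monoid \<Rightarrow> ('g \<Rightarrow> 'o \<Rightarrow> 'o \<Rightarrow> 'm set) \<Rightarrow> ('o, 'm, 'k::field) kcat \<Rightarrow> bool" where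
  "is_grading G X B \<longleftrightarrow> group G \<and> k_category B \<and>
     (\<forall>x\<in>Obj B. \<forall>y\<in>Obj B. internal_direct_sum (Hom B x y) (carrier G) (\<lambda>s. X s x y)) \<and>
     (\<forall>x\<in>Obj B. \<forall>y\<in>Obj B. \<forall>z\<in>Obj B. \<forall>s\<in>carrier G. \<forall>t\<in>carrier G.
        \<forall>f\<in>X s x y. \<forall>g\<in>X t y z. Comp B x y z g f \<in> X (t \<otimes>\<^bsub>G\<^esub> s) x z)"


section \<open>Walks\<close>

text \<open>\<open>Fwd x y f\<close> is \<open>(f, +1)\<close> and \<open>Bwd x y f\<close> is \<open>(f, -1)\<close>, for a morphism \<open>f\<close> from \<open>x\<close> to \<open>y\<close>.\<close>

datatype ('o, 'm) signed_mor = Fwd 'o 'o 'm | Bwd 'o 'o 'm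

fun source :: "('o, 'm) signed_mor \<Rightarrow> 'o" where
  "source (Fwd x y f) = x"
| "source (Bwd x y f) = y"

fun target :: "('o, 'm) signed_mor \<Rightarrow> 'o" where
  "target (Fwd x y f) = y"
| "target (Bwd x y f) = x"

definition nonzero_mor :: "('o, 'm, 'k) kcat \<Rightarrow> 'o \<Rightarrow> 'o \<Rightarrow> 'm \<Rightarrow> bool" where
  "nonzero_mor B x y f \<longleftrightarrow>
     x \<in> Obj B \<and> y \<in> Obj B \<and> f \<in> carrier (Hom B x y) \<and> f \<noteq> \<zero>\<^bsub>Hom B x y\<^esub>"

fun nonzero_signed_mor :: "('o, 'm, 'k) kcat \<Rightarrow> ('o, 'm) signed_mor \<Rightarrow> bool" where
  "nonzero_signed_mor B (Fwd x y f) = nonzero_mor B x y f"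
| "nonzero_signed_mor B (Bwd x y f) = nonzero_mor B x y f"

text \<open>Walks are listed in composition order: the last list entry is travelled first.  They have
  at least one entry.\<close>

definition nonzero_walk ::
  "('o, 'm, 'k) kcat \<Rightarrow> 'o \<Rightarrow> ('o, 'm) signed_mor list \<Rightarrow> 'o \<Rightarrow> bool" where
  "nonzero_walk B x w y \<longleftrightarrow> w \<noteq> [] \<and> (\<forall>v\<in>set w. nonzero_signed_mor B v) \<and>
     successively (\<lambda>u v. source u = target v) w \<and> source (last w) = x \<and> target (hd w) = y"

definition connected_kcat :: "('o, 'm, 'k::field) kcat \<Rightarrow> bool" where
  "connected_kcat B \<longleftrightarrow> k_category B \<and> (\<forall>x\<in>Obj B. \<forall>y\<in>Obj B. \<exists>w. nonzero_walk B x w y)"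

fun homogeneous :: "'g monoid \<Rightarrow> ('g \<Rightarrow> 'o \<Rightarrow> 'o \<Rightarrow> 'm set) \<Rightarrow> ('o, 'm) signed_mor \<Rightarrow> bool" where
  "homogeneous G X (Fwd x y f) = (\<exists>s\<in>carrier G. f \<in> X s x y)"
| "homogeneous G X (Bwd x y f) = (\<exists>s\<in>carrier G. f \<in> X s x y)"

text \<open>The degree is well defined only for a non-zero homogeneous morphism.\<close>

definition degree_of ::
  "'g monoid \<Rightarrow> ('g \<Rightarrow> 'o \<Rightarrow> 'o \<Rightarrow> 'm set) \<Rightarrow> 'o \<Rightarrow> 'o \<Rightarrow> 'm \<Rightarrow> 'g" where
  "degree_of G X x y f = (THE s. s \<in> carrier G \<and> f \<in> X s x y)"

fun walk_degree ::
  "'g monoid \<Rightarrow> ('g \<Rightarrow> 'o \<Rightarrow> 'o \<Rightarrow> 'm set) \<Rightarrow> ('o, 'm) signed_mor list \<Rightarrow> 'g" where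
  "walk_degree G X [] = \<one>\<^bsub>G\<^esub>"
| "walk_degree G X (Fwd x y f # w) = degree_of G X x y f \<otimes>\<^bsub>G\<^esub> walk_degree G X w"
| "walk_degree G X (Bwd x y f # w) = inv\<^bsub>G\<^esub> (degree_of G X x y f) \<otimes>\<^bsub>G\<^esub> walk_degree G X w"

definition connected_grading ::
  "'g monoid \<Rightarrow> ('g \<Rightarrow> 'o \<Rightarrow> 'o \<Rightarrow> 'm set) \<Rightarrow> ('o, 'm, 'k::field) kcat \<Rightarrow> bool" where
  "connected_grading G X B \<longleftrightarrow> is_grading G X B \<and>
     (\<forall>x\<in>Obj B. \<forall>y\<in>Obj B. \<forall>s\<in>carrier G.
        \<exists>w. nonzero_walk B x w y \<and> (\<forall>v\<in>set w. homogeneous G X v) \<and> walk_degree G X w = s)"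


section \<open>Smash products and simple connectedness\<close>

definition smash ::
  "('o, 'm, 'k) kcat \<Rightarrow> 'g monoid \<Rightarrow> ('g \<Rightarrow> 'o \<Rightarrow> 'o \<Rightarrow> 'm set) \<Rightarrow> ('o \<times> 'g, 'm, 'k) kcat" where
  "smash B G X =
    \<lparr>Obj = Obj B \<times> carrier G,
     Hom = (\<lambda>(b, g) (c, h). (Hom B b c)\<lparr>carrier := X (inv\<^bsub>G\<^esub> h \<otimes>\<^bsub>G\<^esub> g) b c\<rparr>),
     Comp = (\<lambda>(b, g) (c, h) (d, l). Comp B b c d),
     Id = (\<lambda>(b, g). Id B b)\<rparr>"

text \<open>HOL cannot quantify over types inside a formula, so the grading groups range over all groups
  with elements in the type \<open>'d\<close>.  A statement with \<open>'d\<close> a type variable covers all groups.\<close>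

definition simply_connected_kcat :: "'d itself \<Rightarrow> ('o, 'm, 'k::field) kcat \<Rightarrow> bool" where
  "simply_connected_kcat (_ :: 'd itself) B \<longleftrightarrow> connected_kcat B \<and>
     (\<forall>(D :: 'd monoid) Y. connected_grading D Y B \<longrightarrow> carrier D = {\<one>\<^bsub>D\<^esub>})"

definition simply_connected_grading ::
  "'d itself \<Rightarrow> 'g monoid \<Rightarrow> ('g \<Rightarrow> 'o \<Rightarrow> 'o \<Rightarrow> 'm set) \<Rightarrow> ('o, 'm, 'k::field) kcat \<Rightarrow> bool" where
  "simply_connected_grading T G X B \<longleftrightarrow>
     connected_grading G X B \<and> simply_connected_kcat T (smash B G X)"


section \<open>Free groups\<close>

text \<open>The free group on \<open>I\<close>, realised on reduced words; \<open>(i, True)\<close> stands for the generator \<open>i\<close>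
  and \<open>(i, False)\<close> for its inverse.\<close>

definition cancels :: "'i \<times> bool \<Rightarrow> 'i \<times> bool \<Rightarrow> bool" where
  "cancels a b \<longleftrightarrow> fst a = fst b \<and> snd a \<noteq> snd b"

fun push_letter :: "'i \<times> bool \<Rightarrow> ('i \<times> bool) list \<Rightarrow> ('i \<times> bool) list" where
  "push_letter a [] = [a]"
| "push_letter a (b # w) = (if cancels a b then w else a # b # w)"

definition free_group :: "'i set \<Rightarrow> ('i \<times> bool) list monoid" where
  "free_group I =
    \<lparr>carrier = {w. fst ` set w \<subseteq> I \<and> successively (\<lambda>a b. \<not> cancels a b) w},
     mult = (\<lambda>u v. foldr push_letter u v),
     one = []\<rparr>"

definition gen :: "'i \<Rightarrow> ('i \<times> bool) list" where
  "gen i = [(i, True)]"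


section \<open>The grading of the matrix algebra\<close>

definition primitive_root_of_unity :: "nat \<Rightarrow> 'k::field \<Rightarrow> bool" where
  "primitive_root_of_unity n \<zeta> \<longleftrightarrow> n > 0 \<and> \<zeta> ^ n = 1 \<and> (\<forall>m. 0 < m \<and> m < n \<longrightarrow> \<zeta> ^ m \<noteq> 1)"

definition matrix_kcat :: "'k::field itself \<Rightarrow> nat \<Rightarrow> (unit, 'k mat, 'k) kcat" where
  "matrix_kcat T n = one_object_kcat (module_mat T n n)"

text \<open>Row \<open>j\<close> and column \<open>i\<close> are counted from 1, whereas the library counts from 0.\<close>

definition matrix_unit :: "nat \<Rightarrow> nat \<Rightarrow> nat \<Rightarrow> 'k::field mat" where
  "matrix_unit n j i = mat n n (\<lambda>(a, b). if Suc a = j \<and> Suc b = i then 1 else 0)"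

abbreviation matrix_grading_group :: "nat \<Rightarrow> (nat \<times> bool) list monoid" where
  "matrix_grading_group n \<equiv> free_group {1..n - 1}"

text \<open>The degrees of the remaining matrix units are forced by multiplicativity, so these conditions
  determine all components \<open>X s\<close> with \<open>s\<close> in the group.\<close>

definition is_matrix_unit_grading ::
  "'k::field itself \<Rightarrow> nat \<Rightarrow> ((nat \<times> bool) list \<Rightarrow> unit \<Rightarrow> unit \<Rightarrow> 'k mat set) \<Rightarrow> bool" where
  "is_matrix_unit_grading T n X \<longleftrightarrow>
     is_grading (matrix_grading_group n) X (matrix_kcat T n) \<and>
     (\<forall>i\<in>{1..n}. \<forall>j\<in>{1..n}. \<exists>s\<in>carrier (matrix_grading_group n). matrix_unit n j i \<in> X s () ()) \<and>
     (\<forall>i\<in>{1..n}. matrix_unit n i i \<in> X \<one>\<^bsub>matrix_grading_group n\<^esub> () ()) \<and>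
     (\<forall>i\<in>{1..n - 1}.
        matrix_unit n (i + 1) i \<in> X (gen i) () () \<and>
        matrix_unit n i (i + 1) \<in> X (inv\<^bsub>matrix_grading_group n\<^esub> (gen i)) () ())"

end

theory Submission
  imports Defs
begin

text \<open>Write \<open>F\<close> for the free group and \<open>e\<close> for a matrix unit of row \<open>j\<close> and column \<open>i\<close>.  With
  \<open>d j = s_(j-1) ... s_1\<close>, multiplicativity forces the degree of \<open>e\<close> to be
  \<open>d j \<otimes> inv (d i)\<close>.  These degrees form a cocycle, so the matrices supported on the entries of a given
  degree are the components of a grading, and every grading of the required kind has these
  components.  The generators occur as degrees, so the grading is connected, and therefore so is the
  smash product: homogeneous walks lift (\<open>homogeneous_walk_lift\<close>, \<open>connected_smash\<close>).

  In the smash product, the matrix unit \<open>e\<close> is a morphism out of every object, and if \<open>i\<close> and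
  \<open>j\<close> differ it spans its morphism space, because abelianising \<open>F\<close> shows that no other
  matrix unit has the same degree.  For every grading of the smash product by a group \<open>D\<close>, these
  morphisms are therefore homogeneous (\<open>matrix_unit_homogeneous\<close>).  A diagonal unit is the product of
  two such morphisms (or, for \<open>n = 1\<close>, itself spans its morphism space), hence homogeneous, and as an
  idempotent it has trivial degree (\<open>diagonal_unit_degree\<close>).  So the matrix unit opposite to \<open>e\<close> has the inverse degree, and all degrees are
  determined by those of the subdiagonal units, that is, by a labelling in \<open>D\<close> of the edges of the
  Cayley graph of \<open>F\<close>.

  This graph is a tree, so the edge labels are differences of a labelling \<open>\<psi>\<close> of its vertices
  (\<open>cayley_tree_potential\<close>).  By multiplicativity the degree of every matrix unit is the difference of
  the labels of its end points (\<open>smash_grading_potential\<close>), and cutting an entry out of a homogeneous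
  morphism with two diagonal units extends this to every non-zero homogeneous morphism
  (\<open>homogeneous_morphism_degree\<close>).  Along a closed walk the differences cancel.  If the
  grading by \<open>D\<close> is connected, every element of \<open>D\<close> is the degree of a closed walk, and thus \<open>D\<close> is
  trivial.\<close>

section \<open>Free groups and their Cayley trees\<close>

definition flip :: "'i \<times> bool \<Rightarrow> 'i \<times> bool" where
  "flip a = (fst a, \<not> snd a)"

lemma cancels_flip: "cancels a b \<longleftrightarrow> b = flip a"
  by (cases a; cases b) (auto simp: cancels_def flip_def)

lemma flip_flip [simp]: "flip (flip a) = a"
  by (simp add: flip_def)

abbreviation reduced :: "('i \<times> bool) list \<Rightarrow> bool" where
  "reduced \<equiv> successively (\<lambda>a b. \<not> cancels a b)"

lemma reduced_push_letter: "reduced w \<Longrightarrow> reduced (push_letter a w)"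
  by (cases w) (auto simp: successively_Cons)

text \<open>If \<open>w = a # v\<close>, the inner push deletes \<open>a\<close>, and the outer one restores it only because \<open>v\<close>,
  the tail of a reduced word, does not start with \<open>flip a\<close>.\<close>

lemma push_letter_cancel:
  assumes "reduced w"
  shows "push_letter a (push_letter (flip a) w) = w"
proof (cases w)
  case (Cons b v)
  then show ?thesis using assms by (cases v) (auto simp: cancels_flip)
qed (simp add: cancels_flip)

lemma reduced_foldr_push_letter: "reduced w \<Longrightarrow> reduced (foldr push_letter u w)"
  by (induction u) (auto simp: reduced_push_letter)

text \<open>This carries associativity: a cancellation inside the left factor is matched by two mutually
  inverse pushes onto the right factor.\<close>

lemma foldr_push_letter_push_letter:
  assumes "reduced w"
  shows "foldr push_letter (push_letter a u) w = push_letter a (foldr push_letter u w)"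
proof (cases u)
  case (Cons b v)
  have "push_letter a (push_letter (flip a) (foldr push_letter v w)) = foldr push_letter v w"
    using assms by (intro push_letter_cancel reduced_foldr_push_letter)
  then show ?thesis using Cons by (auto simp: cancels_flip)
qed simp

lemma foldr_push_letter_assoc:
  assumes "reduced w"
  shows "foldr push_letter (foldr push_letter u v) w = foldr push_letter u (foldr push_letter v w)"
  using assms by (induction u) (auto simp: foldr_push_letter_push_letter)

lemma push_letter_reduced: "reduced (a # w) \<Longrightarrow> push_letter a w = a # w"
  by (cases w) auto

lemma set_foldr_push_letter: "set (foldr push_letter u w) \<subseteq> set u \<union> set w"
proof (induction u)
  case (Cons a u)
  have "set (push_letter a v) \<subseteq> insert a (set v)" for v
    by (cases v) auto
  then show ?case using Cons by fastforce
qed simp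

text \<open>The first factor is pushed starting from its last letter, the inverse of the head of
  \<open>w\<close>, so the letters of \<open>w\<close> disappear one by one.\<close>

lemma foldr_push_letter_inverse:
  "reduced w \<Longrightarrow> foldr push_letter (map flip (rev w)) w = []"
  by (induction w) (auto simp: cancels_flip successively_Cons)

lemma mem_free_group: "w \<in> carrier (free_group I) \<longleftrightarrow> fst ` set w \<subseteq> I \<and> reduced w"
  by (simp add: free_group_def)

lemma mult_free_group: "u \<otimes>\<^bsub>free_group I\<^esub> v = foldr push_letter u v"
  by (simp add: free_group_def)

lemma one_free_group: "\<one>\<^bsub>free_group I\<^esub> = []"
  by (simp add: free_group_def)

lemma group_free_group: "group (free_group I)"
proof (rule groupI)
  fix x y assume xy: "x \<in> carrier (free_group I)" "y \<in> carrier (free_group I)"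
  have "fst ` set (foldr push_letter x y) \<subseteq> fst ` set x \<union> fst ` set y"
    using set_foldr_push_letter[of x y] by blast
  also have "\<dots> \<subseteq> I" using xy by (simp add: mem_free_group)
  finally show "x \<otimes>\<^bsub>free_group I\<^esub> y \<in> carrier (free_group I)"
    using xy by (simp add: mem_free_group mult_free_group reduced_foldr_push_letter)
next
  fix x assume x: "x \<in> carrier (free_group I)"
  have "reduced (map flip (rev x))"
    using x by (simp add: mem_free_group successively_map successively_rev)
      (simp add: cancels_def flip_def eq_commute)
  then show "\<exists>y\<in>carrier (free_group I). y \<otimes>\<^bsub>free_group I\<^esub> x = \<one>\<^bsub>free_group I\<^esub>"
    using x foldr_push_letter_inverse[of x]
    by (intro bexI[of _ "map flip (rev x)"])
      (auto simp: mem_free_group mult_free_group one_free_group flip_def)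
qed (auto simp: mem_free_group mult_free_group one_free_group foldr_push_letter_assoc)

lemma Cons_eq_mult_free_group:
  "a # w \<in> carrier (free_group I) \<Longrightarrow> a # w = [a] \<otimes>\<^bsub>free_group I\<^esub> w"
  by (auto simp: mem_free_group mult_free_group push_letter_reduced)

lemma Cons_mem_free_group:
  "a # w \<in> carrier (free_group I) \<Longrightarrow> fst a \<in> I \<and> w \<in> carrier (free_group I)"
  by (auto simp: mem_free_group successively_Cons)

lemma singleton_mem_free_group: "[a] \<in> carrier (free_group I) \<longleftrightarrow> fst a \<in> I"
  by (simp add: mem_free_group)

lemma gen_mem_free_group: "i \<in> I \<Longrightarrow> gen i \<in> carrier (free_group I)"
  by (simp add: gen_def singleton_mem_free_group)

lemma inv_gen:
  assumes "i \<in> I"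
  shows "inv\<^bsub>free_group I\<^esub> (gen i) = [(i, False)]"
proof -
  have "[(i, False)] \<otimes>\<^bsub>free_group I\<^esub> gen i = \<one>\<^bsub>free_group I\<^esub>"
    by (simp add: mult_free_group one_free_group gen_def cancels_def)
  then show ?thesis
    using assms group.inv_equality[OF group_free_group]
    by (metis fst_conv gen_mem_free_group singleton_mem_free_group)
qed

text \<open>The group elements are the vertices of the Cayley graph, and an edge joins \<open>w\<close> to
  \<open>gen i \<otimes> w\<close>.  Since this graph is a tree, edge labels in any group are differences of a vertex
  labelling: the reduced word is the only path without backtracking from the base point, and the
  label of its end is the product of the edge labels along it.\<close>

lemma cayley_tree_potential:
  fixes \<delta> :: "'i \<Rightarrow> ('i \<times> bool) list \<Rightarrow> 'd" and D :: "'d monoid"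
  assumes "group D"
    and \<delta>: "\<And>i w. i \<in> I \<Longrightarrow> w \<in> carrier (free_group I) \<Longrightarrow> \<delta> i w \<in> carrier D"
  shows "\<exists>\<psi>. (\<forall>w\<in>carrier (free_group I). \<psi> w \<in> carrier D) \<and>
    (\<forall>i\<in>I. \<forall>w\<in>carrier (free_group I).
       \<psi> (gen i \<otimes>\<^bsub>free_group I\<^esub> w) = \<delta> i w \<otimes>\<^bsub>D\<^esub> \<psi> w)"
proof -
  interpret D: group D by fact
  \<comment> \<open>A positive head letter traverses the edge that starts at the tail \<open>w\<close>; a negative one
    traverses backwards the edge that starts at the whole word \<open>a # w\<close>.\<close>
  define \<psi> where "\<psi> = rec_list \<one>\<^bsub>D\<^esub> (\<lambda>a w r.
    if snd a then \<delta> (fst a) w \<otimes>\<^bsub>D\<^esub> r else inv\<^bsub>D\<^esub> (\<delta> (fst a) (a # w)) \<otimes>\<^bsub>D\<^esub> r)"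
  have \<psi>_closed: "\<psi> w \<in> carrier D" if "w \<in> carrier (free_group I)" for w
    using that
  proof (induction w)
    case (Cons a w)
    then show ?case
      using Cons_mem_free_group[OF Cons.prems] \<delta> by (auto simp: \<psi>_def)
  qed (simp add: \<psi>_def)
  have "\<psi> (push_letter (i, True) w) = \<delta> i w \<otimes>\<^bsub>D\<^esub> \<psi> w"
    if i: "i \<in> I" and w: "w \<in> carrier (free_group I)" for i w
  proof (cases "\<exists>v. w = (i, False) # v")
    case True
    then obtain v where v: "w = (i, False) # v" by blast
    then have "\<psi> w = inv\<^bsub>D\<^esub> (\<delta> i w) \<otimes>\<^bsub>D\<^esub> \<psi> v" by (simp add: \<psi>_def)
    moreover have "\<psi> v \<in> carrier D" using \<psi>_closed Cons_mem_free_group w v by metis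
    ultimately show ?thesis
      using v \<delta>[OF i w] by (simp add: cancels_def D.m_assoc[symmetric])
  next
    case False
    then have "push_letter (i, True) w = (i, True) # w"
      by (cases w) (auto simp: cancels_flip flip_def)
    then show ?thesis by (simp add: \<psi>_def)
  qed
  then show ?thesis
    using \<psi>_closed by (intro exI[of _ \<psi>]) (auto simp: mult_free_group gen_def)
qed

text \<open>The exponent sum of a letter, a homomorphism to the integers that tells degrees apart.\<close>

fun exponent :: "'i \<Rightarrow> ('i \<times> bool) list \<Rightarrow> int" where
  "exponent i [] = 0"
| "exponent i ((j, b) # w) = (if i = j then if b then 1 else - 1 else 0) + exponent i w"

lemma exponent_push_letter: "exponent i (push_letter a w) = exponent i [a] + exponent i w"
  by (cases w; cases a) (auto simp: cancels_def)

lemma exponent_mult: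
  "exponent i (u \<otimes>\<^bsub>free_group I\<^esub> v) = exponent i u + exponent i v"
proof -
  have "exponent i (foldr push_letter u v) = exponent i u + exponent i v"
  proof (induction u)
    case (Cons a u)
    then show ?case by (cases a) (simp add: exponent_push_letter)
  qed simp
  then show ?thesis by (simp add: mult_free_group)
qed

lemma exponent_inv:
  assumes "u \<in> carrier (free_group I)"
  shows "exponent i (inv\<^bsub>free_group I\<^esub> u) = - exponent i u"
  using exponent_mult[of i I "inv\<^bsub>free_group I\<^esub> u" u]
  by (simp add: group.l_inv[OF group_free_group assms] one_free_group)

section \<open>Direct sums and gradings\<close>

lemma subspaceD:
  assumes "subspace class_ring W V"
  shows subspace_subset: "W \<subseteq> carrier V"
    and subspace_zero: "\<zero>\<^bsub>V\<^esub> \<in> W"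
    and subspace_add: "v \<in> W \<Longrightarrow> w \<in> W \<Longrightarrow> v \<oplus>\<^bsub>V\<^esub> w \<in> W"
    and subspace_smult: "v \<in> W \<Longrightarrow> a \<odot>\<^bsub>V\<^esub> v \<in> W"
proof -
  interpret submodule class_ring W V using assms by (simp add: subspace_def)
  show "W \<subseteq> carrier V" "\<zero>\<^bsub>V\<^esub> \<in> W"
    "v \<in> W \<Longrightarrow> w \<in> W \<Longrightarrow> v \<oplus>\<^bsub>V\<^esub> w \<in> W" "v \<in> W \<Longrightarrow> a \<odot>\<^bsub>V\<^esub> v \<in> W"
    using subset zero_closed m_closed smult_closed by (auto simp: class_ring_simps)
qed

text \<open>The two families concentrated in a single degree, \<open>s\<close> or \<open>t\<close>, both decompose \<open>v\<close>.\<close>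

lemma direct_sum_component_unique:
  fixes S :: "'s set"
  assumes "vectorspace class_ring V" and sum: "internal_direct_sum V S W"
    and st: "s \<in> S" "t \<in> S" and v: "v \<in> W s" "v \<in> W t" "v \<noteq> \<zero>\<^bsub>V\<^esub>"
  shows "s = t"
proof -
  interpret vectorspace class_ring V by fact
  have sub: "\<And>r. r \<in> S \<Longrightarrow> subspace class_ring (W r) V"
    using sum by (simp add: internal_direct_sum_def)
  have vV: "v \<in> carrier V" using subspace_subset[OF sub] v st by blast
  define c where "c = (\<lambda>(r :: 's) q. if q = r then v else \<zero>\<^bsub>V\<^esub>)"
  have supp: "{q. c r q \<noteq> \<zero>\<^bsub>V\<^esub>} = {r}" for r using v by (auto simp: c_def)
  let ?P = "\<lambda>c. finite {q. c q \<noteq> \<zero>\<^bsub>V\<^esub>} \<and> v = (\<Oplus>\<^bsub>V\<^esub>q\<in>{q. c q \<noteq> \<zero>\<^bsub>V\<^esub>}. c q) \<and>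
     (\<forall>q\<in>S. c q \<in> W q) \<and> (\<forall>q. q \<notin> S \<longrightarrow> c q = \<zero>\<^bsub>V\<^esub>)"
  have P: "?P (c r)" if "r \<in> S" "v \<in> W r" for r
  proof (intro conjI ballI allI impI)
    show "finite {q. c r q \<noteq> \<zero>\<^bsub>V\<^esub>}" by (simp only: supp finite.intros)
    have "(\<Oplus>\<^bsub>V\<^esub>q\<in>{r}. c r q) = c r r" using vV by (simp add: c_def)
    then show "v = (\<Oplus>\<^bsub>V\<^esub>q\<in>{q. c r q \<noteq> \<zero>\<^bsub>V\<^esub>}. c r q)" by (simp only: supp) (simp add: c_def)
    show "c r q \<in> W q" if "q \<in> S" for q
      using \<open>v \<in> W r\<close> subspace_zero[OF sub[OF that]] by (simp add: c_def)
    show "c r q = \<zero>\<^bsub>V\<^esub>" if "q \<notin> S" for q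
      using \<open>r \<in> S\<close> that by (auto simp: c_def)
  qed
  have "\<exists>!c. ?P c" using sum vV unfolding internal_direct_sum_def by simp
  then obtain c' where "\<And>c. ?P c \<Longrightarrow> c = c'" by (rule ex1E) iprover
  from this[OF P[OF st(1) v(1)]] this[OF P[OF st(2) v(2)]] have "c s = c t" by simp
  then have "c s s = c t s" by simp
  then show ?thesis using v by (auto simp: c_def split: if_splits)
qed

text \<open>Some component of \<open>v\<close> is non-zero, hence a non-zero multiple of \<open>v\<close>.  So a morphism that spans its
  morphism space is homogeneous for every grading.\<close>

lemma direct_sum_one_dimensional:
  assumes "vectorspace class_ring V" and sum: "internal_direct_sum V S W"
    and v: "v \<in> carrier V" "v \<noteq> \<zero>\<^bsub>V\<^esub>" and span: "\<And>u. u \<in> carrier V \<Longrightarrow> \<exists>a. u = a \<odot>\<^bsub>V\<^esub> v"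
  shows "\<exists>s\<in>S. v \<in> W s"
proof -
  interpret vectorspace class_ring V by fact
  obtain c where c: "v = (\<Oplus>\<^bsub>V\<^esub>s\<in>{s. c s \<noteq> \<zero>\<^bsub>V\<^esub>}. c s)"
    "\<forall>s\<in>S. c s \<in> W s" "\<forall>s. s \<notin> S \<longrightarrow> c s = \<zero>\<^bsub>V\<^esub>"
    using sum v unfolding internal_direct_sum_def by blast
  have "\<exists>s. c s \<noteq> \<zero>\<^bsub>V\<^esub>"
  proof (rule ccontr)
    assume "\<not> ?thesis"
    then have "{s. c s \<noteq> \<zero>\<^bsub>V\<^esub>} = {}" by blast
    then show False using c(1) v by simp
  qed
  then obtain s where s: "c s \<noteq> \<zero>\<^bsub>V\<^esub>" by blast
  then have "s \<in> S" using c(3) by blast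
  have sub: "subspace class_ring (W s) V"
    using sum \<open>s \<in> S\<close> by (simp add: internal_direct_sum_def)
  have "c s \<in> W s" using c(2) \<open>s \<in> S\<close> by blast
  from this obtain a where a: "c s = a \<odot>\<^bsub>V\<^esub> v"
    using span subspace_subset[OF sub] by blast
  have "a \<noteq> 0" using s a lmult_0[OF v(1)] by (auto simp: class_ring_simps)
  have "inverse a \<odot>\<^bsub>V\<^esub> (a \<odot>\<^bsub>V\<^esub> v) = (inverse a * a) \<odot>\<^bsub>V\<^esub> v"
    using smult_assoc1[of "inverse a" a v, symmetric] v(1) by (simp only: class_ring_simps UNIV_I)
  also have "\<dots> = v"
    using smult_one[OF v(1)] by (simp only: class_ring_simps left_inverse[OF \<open>a \<noteq> 0\<close>])
  finally have "v = inverse a \<odot>\<^bsub>V\<^esub> c s" using a by (simp only:)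
  then have "v \<in> W s" using \<open>c s \<in> W s\<close> subspace_smult[OF sub, of "c s" "inverse a"] by (simp only:)
  then show ?thesis using \<open>s \<in> S\<close> by blast
qed

context
  fixes G :: "'g monoid" and X and B :: "('o, 'm, 'k::field) kcat"
  assumes grading: "is_grading G X B"
begin

lemma grading_group: "group G"
  and grading_category: "k_category B"
  using grading by (auto simp: is_grading_def)

lemma grading_direct_sum:
  "x \<in> Obj B \<Longrightarrow> y \<in> Obj B \<Longrightarrow> internal_direct_sum (Hom B x y) (carrier G) (\<lambda>s. X s x y)"
  using grading by (simp add: is_grading_def)

lemma grading_hom_vectorspace:
  "x \<in> Obj B \<Longrightarrow> y \<in> Obj B \<Longrightarrow> vectorspace class_ring (Hom B x y)"
  using k_category.hom_vectorspace[OF grading_category] .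

lemma grading_subspace:
  "x \<in> Obj B \<Longrightarrow> y \<in> Obj B \<Longrightarrow> s \<in> carrier G \<Longrightarrow> subspace class_ring (X s x y) (Hom B x y)"
  using grading_direct_sum by (simp add: internal_direct_sum_def)

lemma grading_comp:
  "x \<in> Obj B \<Longrightarrow> y \<in> Obj B \<Longrightarrow> z \<in> Obj B \<Longrightarrow> s \<in> carrier G \<Longrightarrow> t \<in> carrier G \<Longrightarrow>
    f \<in> X s x y \<Longrightarrow> g \<in> X t y z \<Longrightarrow> Comp B x y z g f \<in> X (t \<otimes>\<^bsub>G\<^esub> s) x z"
  using grading by (simp add: is_grading_def)

lemma grading_degree_unique:
  assumes "x \<in> Obj B" "y \<in> Obj B" "s \<in> carrier G" "t \<in> carrier G"
    and "f \<in> X s x y" "f \<in> X t x y" "f \<noteq> \<zero>\<^bsub>Hom B x y\<^esub>"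
  shows "s = t"
  using direct_sum_component_unique[OF grading_hom_vectorspace grading_direct_sum] assms by blast

lemma degree_of_eq:
  assumes "nonzero_mor B x y f" "s \<in> carrier G" "f \<in> X s x y"
  shows "degree_of G X x y f = s"
  unfolding degree_of_def using assms grading_degree_unique
  by (intro the_equality) (auto simp: nonzero_mor_def)

text \<open>The degree of a non-zero homogeneous idempotent equals its own square.\<close>

lemma idempotent_degree:
  assumes "x \<in> Obj B" "s \<in> carrier G" "e \<in> X s x x" "e \<noteq> \<zero>\<^bsub>Hom B x x\<^esub>" "Comp B x x x e e = e"
  shows "s = \<one>\<^bsub>G\<^esub>"
proof -
  interpret group G by (rule grading_group)
  have "e \<in> X (s \<otimes>\<^bsub>G\<^esub> s) x x" using grading_comp[of x x x s s e e] assms by simp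
  then have "s \<otimes>\<^bsub>G\<^esub> s = s" using grading_degree_unique[of x x "s \<otimes>\<^bsub>G\<^esub> s" s e] assms by simp
  then show ?thesis using assms by simp
qed

end

section \<open>The smash product category\<close>

lemma Obj_smash: "Obj (smash B G X) = Obj B \<times> carrier G"
  by (simp add: smash_def)

lemma Hom_smash: "Hom (smash B G X) (b, g) (c, h) =
    (Hom B b c)\<lparr>carrier := X (inv\<^bsub>G\<^esub> h \<otimes>\<^bsub>G\<^esub> g) b c\<rparr>"
  by (simp add: smash_def)

lemma Comp_smash: "Comp (smash B G X) (b, g) (c, h) (d, l) = Comp B b c d"
  by (simp add: smash_def)

text \<open>The smash product is defined by matching on pairs; these forms apply to objects that are
  variables.\<close>

lemma smash_projections:
  "carrier (Hom (smash B G X) x y) = X (inv\<^bsub>G\<^esub> (snd y) \<otimes>\<^bsub>G\<^esub> snd x) (fst x) (fst y)"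
  "f \<oplus>\<^bsub>Hom (smash B G X) x y\<^esub> f' = f \<oplus>\<^bsub>Hom B (fst x) (fst y)\<^esub> f'"
  "a \<odot>\<^bsub>Hom (smash B G X) x y\<^esub> f = a \<odot>\<^bsub>Hom B (fst x) (fst y)\<^esub> f"
  "Comp (smash B G X) x y z = Comp B (fst x) (fst y) (fst z)"
  "Id (smash B G X) x = Id B (fst x)"
  "x \<in> Obj (smash B G X) \<longleftrightarrow> fst x \<in> Obj B \<and> snd x \<in> carrier G"
  by (cases x; cases y; cases z; simp add: smash_def)+

lemmas smash_simps = Obj_smash Hom_smash Comp_smash

lemma nonzero_mor_smash:
  assumes "is_grading G X B"
  shows "nonzero_mor (smash B G X) (b, g) (c, h) f \<longleftrightarrow>
    g \<in> carrier G \<and> h \<in> carrier G \<and> f \<in> X (inv\<^bsub>G\<^esub> h \<otimes>\<^bsub>G\<^esub> g) b c \<and> nonzero_mor B b c f"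
proof -
  interpret group G using grading_group[OF assms] .
  show ?thesis
    using subspace_subset[OF grading_subspace[OF assms], of b c "inv\<^bsub>G\<^esub> h \<otimes>\<^bsub>G\<^esub> g"]
    by (auto simp: nonzero_mor_def smash_simps)
qed

lemma subspace_vectorspace:
  assumes "subspace class_ring W V"
  shows "vectorspace class_ring (V\<lparr>carrier := W\<rparr>)"
  using vectorspace.subspace_is_vs[OF _ assms] assms by (simp add: subspace_def)

text \<open>The axioms are inherited from \<open>B\<close>; closure under composition holds because consecutive
  differences of group components multiply to the total difference.  The identities have to be
  of degree one in order to lie in the endomorphism spaces.\<close>

lemma k_category_smash:
  fixes B :: "('o, 'm, 'k::field) kcat"
  assumes gr: "is_grading G X B" and id: "\<And>b. b \<in> Obj B \<Longrightarrow> Id B b \<in> X \<one>\<^bsub>G\<^esub> b b"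
  shows "k_category (smash B G X)"
proof -
  interpret group G using grading_group[OF gr] .
  interpret B: k_category B using grading_category[OF gr] .
  have mem: "f \<in> carrier (Hom B (fst p) (fst q))"
    if "p \<in> Obj (smash B G X)" "q \<in> Obj (smash B G X)" "f \<in> carrier (Hom (smash B G X) p q)" for p q f
    using subspace_subset[OF grading_subspace[OF gr, of "fst p" "fst q"
        "inv\<^bsub>G\<^esub> (snd q) \<otimes>\<^bsub>G\<^esub> snd p"]] that
    by (auto simp: smash_projections)
  have obj: "fst p \<in> Obj B" if "p \<in> Obj (smash B G X)" for p
    using that by (simp add: smash_projections)
  have deg: "(inv\<^bsub>G\<^esub> l \<otimes>\<^bsub>G\<^esub> h) \<otimes>\<^bsub>G\<^esub> (inv\<^bsub>G\<^esub> h \<otimes>\<^bsub>G\<^esub> g) = inv\<^bsub>G\<^esub> l \<otimes>\<^bsub>G\<^esub> g"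
    if "g \<in> carrier G" "h \<in> carrier G" "l \<in> carrier G" for g h l
  proof -
    have "(inv\<^bsub>G\<^esub> l \<otimes>\<^bsub>G\<^esub> h) \<otimes>\<^bsub>G\<^esub> (inv\<^bsub>G\<^esub> h \<otimes>\<^bsub>G\<^esub> g) = inv\<^bsub>G\<^esub> l \<otimes>\<^bsub>G\<^esub> (h \<otimes>\<^bsub>G\<^esub> inv\<^bsub>G\<^esub> h) \<otimes>\<^bsub>G\<^esub> g"
      using that by (simp only: m_assoc inv_closed m_closed)
    then show ?thesis using that by simp
  qed
  show ?thesis
  proof (rule k_category.intro, goal_cases)
    case (1 x y)
    then show ?case
      by (auto simp: smash_simps intro!: subspace_vectorspace grading_subspace[OF gr])
  next
    case (2 x y z f g)
    then show ?case
      using grading_comp[OF gr, of "fst x" "fst y" "fst z" "inv\<^bsub>G\<^esub> (snd y) \<otimes>\<^bsub>G\<^esub> snd x"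
          "inv\<^bsub>G\<^esub> (snd z) \<otimes>\<^bsub>G\<^esub> snd y" f g] deg[of "snd x" "snd y" "snd z"]
      by (simp add: smash_projections)
  next
    case (3 x y z f g g')
    then show ?case
      by (simp only: smash_projections(2-5) obj mem B.comp_add_left)
  next
    case (4 x y z f f' g)
    then show ?case
      by (simp only: smash_projections(2-5) obj mem B.comp_add_right)
  next
    case (5 x y z f g a)
    then show ?case
      by (simp only: smash_projections(2-5) obj mem B.comp_smult_left)
  next
    case (6 x y z f g a)
    then show ?case
      by (simp only: smash_projections(2-5) obj mem B.comp_smult_right)
  next
    case (7 w x y z f g h)
    then show ?case
      by (simp only: smash_projections(2-5) obj mem B.comp_assoc)
  next
    case (8 x)
    then show ?case using id[of "fst x"] by (simp add: smash_projections)
  next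
    case (9 x y f)
    then show ?case
      by (simp only: smash_projections(2-5) obj mem B.id_left)
  next
    case (10 x y f)
    then show ?case
      by (simp only: smash_projections(2-5) obj mem B.id_right)
  qed
qed

text \<open>The projection of the smash product onto \<open>B\<close> has unique lifts of homogeneous morphisms, as a
  covering has for paths: one of degree \<open>s\<close> multiplies the group component by the inverse of \<open>s\<close> on
  the right.  For a backward step the signed degree is the inverse of that of the morphism.\<close>

lemma homogeneous_signed_mor_lift:
  assumes gr: "is_grading G X B" and v: "nonzero_signed_mor B v" "homogeneous G X v"
    and g: "g \<in> carrier G"
  shows "\<exists>s\<in>carrier G. \<exists>v'. (\<forall>w. walk_degree G X (v # w) = s \<otimes>\<^bsub>G\<^esub> walk_degree G X w) \<and>
    nonzero_signed_mor (smash B G X) v' \<and> source v' = (source v, g) \<and>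
    target v' = (target v, g \<otimes>\<^bsub>G\<^esub> inv\<^bsub>G\<^esub> s)"
proof -
  interpret group G using grading_group[OF gr] .
  show ?thesis
  proof (cases v)
    case (Fwd x y f)
    with v obtain s where s: "s \<in> carrier G" "f \<in> X s x y" and nz: "nonzero_mor B x y f" by auto
    have "inv\<^bsub>G\<^esub> (g \<otimes>\<^bsub>G\<^esub> inv\<^bsub>G\<^esub> s) \<otimes>\<^bsub>G\<^esub> g = s"
      using g s by (simp add: inv_mult_group m_assoc)
    then show ?thesis
      using Fwd s nz g degree_of_eq[OF gr nz s]
      by (intro bexI[of _ s] exI[of _ "Fwd (x, g) (y, g \<otimes>\<^bsub>G\<^esub> inv\<^bsub>G\<^esub> s) f"])
        (auto simp: nonzero_mor_smash[OF gr])
  next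
    case (Bwd x y f)
    with v obtain s where s: "s \<in> carrier G" "f \<in> X s x y" and nz: "nonzero_mor B x y f" by auto
    have "inv\<^bsub>G\<^esub> g \<otimes>\<^bsub>G\<^esub> (g \<otimes>\<^bsub>G\<^esub> s) = s"
      using g s by (simp add: m_assoc[symmetric])
    then show ?thesis
      using Bwd s nz g degree_of_eq[OF gr nz s]
      by (intro bexI[of _ "inv\<^bsub>G\<^esub> s"] exI[of _ "Bwd (x, g \<otimes>\<^bsub>G\<^esub> s) (y, g) f"])
        (auto simp: nonzero_mor_smash[OF gr])
  qed
qed

lemma homogeneous_walk_lift:
  assumes gr: "is_grading G X B" and g: "g \<in> carrier G"
  shows "nonzero_walk B x w y \<Longrightarrow> \<forall>v\<in>set w. homogeneous G X v \<Longrightarrow>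
    walk_degree G X w \<in> carrier G \<and>
    (\<exists>w'. nonzero_walk (smash B G X) (x, g) w' (y, g \<otimes>\<^bsub>G\<^esub> inv\<^bsub>G\<^esub> (walk_degree G X w)))"
proof (induction w arbitrary: y)
  case Nil
  then show ?case by (simp add: nonzero_walk_def)
next
  case (Cons v w)
  interpret group G using grading_group[OF gr] .
  have v: "nonzero_signed_mor B v" "homogeneous G X v" "target v = y"
    using Cons.prems by (auto simp: nonzero_walk_def)
  show ?case
  proof (cases "w = []")
    case True
    with Cons.prems have "source v = x" by (simp add: nonzero_walk_def)
    then show ?thesis
      using homogeneous_signed_mor_lift[OF gr v(1,2) g] True v(3)
      by (auto simp: nonzero_walk_def intro!: exI[of _ "[_]"])
  next
    case False
    with Cons.prems have w: "nonzero_walk B x w (source v)" "\<forall>v\<in>set w. homogeneous G X v"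
      by (auto simp: nonzero_walk_def successively_Cons)
    define t where "t = walk_degree G X w"
    from Cons.IH[OF w] obtain w' where t: "t \<in> carrier G"
      and w': "nonzero_walk (smash B G X) (x, g) w' (source v, g \<otimes>\<^bsub>G\<^esub> inv\<^bsub>G\<^esub> t)"
      unfolding t_def by blast
    obtain s v' where s: "s \<in> carrier G" "walk_degree G X (v # w) = s \<otimes>\<^bsub>G\<^esub> t"
      and v': "nonzero_signed_mor (smash B G X) v'" "source v' = (source v, g \<otimes>\<^bsub>G\<^esub> inv\<^bsub>G\<^esub> t)"
        "target v' = (y, g \<otimes>\<^bsub>G\<^esub> inv\<^bsub>G\<^esub> t \<otimes>\<^bsub>G\<^esub> inv\<^bsub>G\<^esub> s)"
      using homogeneous_signed_mor_lift[OF gr v(1,2), of "g \<otimes>\<^bsub>G\<^esub> inv\<^bsub>G\<^esub> t"] g t v(3)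
      unfolding t_def by fastforce
    have "nonzero_walk (smash B G X) (x, g) (v' # w') (y, g \<otimes>\<^bsub>G\<^esub> inv\<^bsub>G\<^esub> (s \<otimes>\<^bsub>G\<^esub> t))"
      using w' v' g s t by (cases w') (auto simp: nonzero_walk_def inv_mult_group m_assoc)
    then show ?thesis using s t by auto
  qed
qed

lemma connected_grading_walk:
  assumes "connected_grading G X B" "x \<in> Obj B" "y \<in> Obj B" "s \<in> carrier G"
  obtains w where "nonzero_walk B x w y" "\<forall>v\<in>set w. homogeneous G X v" "walk_degree G X w = s"
proof -
  have "\<exists>w. nonzero_walk B x w y \<and> (\<forall>v\<in>set w. homogeneous G X v) \<and> walk_degree G X w = s"
    using assms by (simp add: connected_grading_def)
  then show ?thesis using that by blast
qed

text \<open>A walk in \<open>B\<close> whose degree is the required difference of group components lifts to a walk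
  between the given objects.\<close>

lemma connected_smash:
  assumes con: "connected_grading G X B" and id: "\<And>b. b \<in> Obj B \<Longrightarrow> Id B b \<in> X \<one>\<^bsub>G\<^esub> b b"
  shows "connected_kcat (smash B G X)"
proof -
  have gr: "is_grading G X B" using con by (simp add: connected_grading_def)
  interpret group G using grading_group[OF gr] .
  have "\<exists>w. nonzero_walk (smash B G X) (b, g) w (c, h)"
    if bc: "b \<in> Obj B" "c \<in> Obj B" and gh: "g \<in> carrier G" "h \<in> carrier G" for b c g h
  proof -
    have s: "inv\<^bsub>G\<^esub> h \<otimes>\<^bsub>G\<^esub> g \<in> carrier G" using gh by simp
    obtain w where w: "nonzero_walk B b w c" "\<forall>v\<in>set w. homogeneous G X v"
      "walk_degree G X w = inv\<^bsub>G\<^esub> h \<otimes>\<^bsub>G\<^esub> g"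
      using connected_grading_walk[OF con bc s] .
    have "g \<otimes>\<^bsub>G\<^esub> inv\<^bsub>G\<^esub> (inv\<^bsub>G\<^esub> h \<otimes>\<^bsub>G\<^esub> g) = h"
      using gh by (simp add: inv_mult_group m_assoc[symmetric])
    then show ?thesis using homogeneous_walk_lift[OF gr gh(1) w(1,2)] w(3) by auto
  qed
  then show ?thesis
    using k_category_smash[OF gr id] by (auto simp: connected_kcat_def Obj_smash)
qed

text \<open>Differences of a potential telescope along a walk, so closed walks have trivial degree, while
  connectedness asks for a closed walk of each degree.\<close>

lemma connected_grading_trivial_if_potential:
  fixes C :: "('o, 'm, 'k::field) kcat"
  assumes con: "connected_grading D Y C" and x: "x \<in> Obj C"
    and \<phi>: "\<And>y. y \<in> Obj C \<Longrightarrow> \<phi> y \<in> carrier D"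
    and deg: "\<And>y z f s. nonzero_mor C y z f \<Longrightarrow> s \<in> carrier D \<Longrightarrow> f \<in> Y s y z \<Longrightarrow>
      s = \<phi> z \<otimes>\<^bsub>D\<^esub> inv\<^bsub>D\<^esub> (\<phi> y)"
  shows "carrier D = {\<one>\<^bsub>D\<^esub>}"
proof -
  have gr: "is_grading D Y C" using con by (simp add: connected_grading_def)
  interpret group D using grading_group[OF gr] .
  have degree_of: "degree_of D Y y z f = \<phi> z \<otimes>\<^bsub>D\<^esub> inv\<^bsub>D\<^esub> (\<phi> y)"
    if "nonzero_mor C y z f" "s \<in> carrier D" "f \<in> Y s y z" for y z f s
    using degree_of_eq[OF gr that] deg[OF that] by simp
  have step: "walk_degree D Y (v # w) = \<phi> (target v) \<otimes>\<^bsub>D\<^esub> inv\<^bsub>D\<^esub> (\<phi> (source v)) \<otimes>\<^bsub>D\<^esub> walk_degree D Y w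
      \<and> \<phi> (source v) \<in> carrier D \<and> \<phi> (target v) \<in> carrier D"
    if "nonzero_signed_mor C v" "homogeneous D Y v" for v w
    using that by (cases v) (auto simp: degree_of nonzero_mor_def inv_mult_group \<phi>)
  have walk: "nonzero_walk C x w y \<Longrightarrow> \<forall>v\<in>set w. homogeneous D Y v \<Longrightarrow>
      walk_degree D Y w = \<phi> y \<otimes>\<^bsub>D\<^esub> inv\<^bsub>D\<^esub> (\<phi> x)" for w y
  proof (induction w arbitrary: y)
    case (Cons v w)
    have v: "nonzero_signed_mor C v" "homogeneous D Y v" "target v = y"
      using Cons.prems by (auto simp: nonzero_walk_def)
    note st = step[OF v(1,2), of w]
    show ?case
    proof (cases "w = []")
      case True
      with Cons.prems have "source v = x" by (simp add: nonzero_walk_def)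
      then show ?thesis using st v(3) True by simp
    next
      case False
      with Cons.prems have "nonzero_walk C x w (source v)" "\<forall>v\<in>set w. homogeneous D Y v"
        by (auto simp: nonzero_walk_def successively_Cons)
      then have "walk_degree D Y w = \<phi> (source v) \<otimes>\<^bsub>D\<^esub> inv\<^bsub>D\<^esub> (\<phi> x)" by (rule Cons.IH)
      moreover have "inv\<^bsub>D\<^esub> (\<phi> (source v)) \<otimes>\<^bsub>D\<^esub> (\<phi> (source v) \<otimes>\<^bsub>D\<^esub> inv\<^bsub>D\<^esub> (\<phi> x)) = inv\<^bsub>D\<^esub> (\<phi> x)"
        using st \<phi>[OF x] by (simp add: m_assoc[symmetric])
      ultimately show ?thesis using st v(3) \<phi>[OF x] by (simp add: m_assoc)
    qed
  qed (simp add: nonzero_walk_def)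
  have "s = \<one>\<^bsub>D\<^esub>" if s: "s \<in> carrier D" for s
  proof -
    obtain w where "nonzero_walk C x w x" "\<forall>v\<in>set w. homogeneous D Y v" "walk_degree D Y w = s"
      using connected_grading_walk[OF con x x s] by blast
    then show ?thesis using walk[of w x] \<phi>[OF x] by simp
  qed
  then show ?thesis by auto
qed

section \<open>Matrix units\<close>

(* Keeps the index sets of the free groups, {1..n - 1}, in the form in which they are stated. *)
declare One_nat_def [simp del]

lemma matrix_kcat_simps:
  "Obj (matrix_kcat TYPE('k::field) n) = {()}"
  "Hom (matrix_kcat TYPE('k) n) x y = module_mat TYPE('k) n n"
  "Comp (matrix_kcat TYPE('k) n) x y z g f = g * f"
  "Id (matrix_kcat TYPE('k) n) x = 1\<^sub>m n"
  by (simp_all add: matrix_kcat_def one_object_kcat_def module_mat_simps)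

lemma k_category_matrix_kcat: "k_category (matrix_kcat TYPE('k::field) n)"
  by (rule k_category.intro)
    (auto simp: matrix_kcat_simps module_mat_simps matrix_vs add_mult_distrib_mat
      mult_add_distrib_mat)

lemma matrix_unit_carrier [simp]: "matrix_unit n j i \<in> carrier_mat n n"
  by (simp add: matrix_unit_def)

lemma dim_matrix_unit [simp]: "dim_row (matrix_unit n j i) = n" "dim_col (matrix_unit n j i) = n"
  by (simp_all add: matrix_unit_def)

lemma index_matrix_unit:
  "a < n \<Longrightarrow> b < n \<Longrightarrow> matrix_unit n j i $$ (a, b) = (if Suc a = j \<and> Suc b = i then 1 else 0)"
  by (simp add: matrix_unit_def)

lemma matrix_unit_nonzero:
  assumes "i \<in> {1..n}" "j \<in> {1..n}"
  shows "matrix_unit n j i \<noteq> (0\<^sub>m n n :: 'k::field mat)"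
proof
  assume "matrix_unit n j i = (0\<^sub>m n n :: 'k mat)"
  then have "matrix_unit n j i $$ (j - 1, i - 1) = (0 :: 'k)" using assms by auto
  then show False using assms by (auto simp: index_matrix_unit)
qed

lemma index_matrix_unit_mult:
  assumes "A \<in> carrier_mat n n" "j \<in> {1..n}" "a < n" "b < n"
  shows "(matrix_unit n l j * A) $$ (a, b) = (if Suc a = l then A $$ (j - 1, b) else 0)"
proof -
  have "(matrix_unit n l j * A) $$ (a, b) =
      (\<Sum>k<n. if Suc a = l \<and> Suc k = j then A $$ (k, b) else 0)"
    using assms by (auto simp: scalar_prod_def index_matrix_unit lessThan_atLeast0 intro!: sum.cong)
  also have "\<dots> = (\<Sum>k<n. if k = j - 1 then if Suc a = l then A $$ (k, b) else 0 else 0)"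
    using assms by (intro sum.cong) auto
  also have "\<dots> = (if Suc a = l then A $$ (j - 1, b) else 0)" using assms by auto
  finally show ?thesis .
qed

lemma index_mult_matrix_unit:
  assumes "A \<in> carrier_mat n n" "j \<in> {1..n}" "a < n" "b < n"
  shows "(A * matrix_unit n j i) $$ (a, b) = (if Suc b = i then A $$ (a, j - 1) else 0)"
proof -
  have "(A * matrix_unit n j i) $$ (a, b) =
      (\<Sum>k<n. if Suc b = i \<and> Suc k = j then A $$ (a, k) else 0)"
    using assms by (auto simp: scalar_prod_def index_matrix_unit lessThan_atLeast0 intro!: sum.cong)
  also have "\<dots> = (\<Sum>k<n. if k = j - 1 then if Suc b = i then A $$ (a, k) else 0 else 0)"
    using assms by (intro sum.cong) auto
  also have "\<dots> = (if Suc b = i then A $$ (a, j - 1) else 0)" using assms by auto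
  finally show ?thesis .
qed

lemma matrix_unit_mult:
  assumes "j \<in> {1..n}"
  shows "matrix_unit n l j * matrix_unit n j i = matrix_unit n l i"
  using assms
  by (intro eq_matI) (auto simp: index_matrix_unit_mult index_matrix_unit matrix_unit_def[of n l i]
      carrier_matD[OF matrix_unit_carrier] simp del: index_mult_mat(1))

lemma matrix_unit_compress:
  assumes "A \<in> carrier_mat n n" "i \<in> {1..n}" "j \<in> {1..n}"
  shows "matrix_unit n j j * (A * matrix_unit n i i) = A $$ (j - 1, i - 1) \<cdot>\<^sub>m matrix_unit n j i"
  using assms
  by (intro eq_matI) (auto simp: index_matrix_unit_mult index_mult_matrix_unit index_matrix_unit
      carrier_matD[OF matrix_unit_carrier] simp del: index_mult_mat(1))

section \<open>Degrees of the matrix units\<close>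

fun descending_word :: "nat \<Rightarrow> (nat \<times> bool) list" where
  "descending_word 0 = []"
| "descending_word (Suc k) = (Suc k, True) # descending_word k"

text \<open>The closed form \<open>s_(j-1) ... s_1 \<otimes> inv (s_(i-1) ... s_1)\<close> covers both \<open>j > i\<close>, where it cancels to
  \<open>s_(j-1) ... s_i\<close>, and \<open>j \<le> i\<close>, and turns the cocycle identity into a cancellation.\<close>

definition unit_degree :: "nat \<Rightarrow> nat \<Rightarrow> nat \<Rightarrow> (nat \<times> bool) list" where
  "unit_degree n j i = descending_word (j - 1) \<otimes>\<^bsub>matrix_grading_group n\<^esub>
     inv\<^bsub>matrix_grading_group n\<^esub> (descending_word (i - 1))"

lemma descending_word_closed: "k < n \<Longrightarrow> descending_word k \<in> carrier (matrix_grading_group n)"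
proof (induction k)
  case (Suc k)
  then show ?case
    by (cases k) (auto simp: mem_free_group cancels_def)
qed (simp add: mem_free_group)

lemma descending_word_Suc:
  assumes "Suc k < n"
  shows "descending_word (Suc k) = gen (Suc k) \<otimes>\<^bsub>matrix_grading_group n\<^esub> descending_word k"
  using Cons_eq_mult_free_group[of "(Suc k, True)" "descending_word k"] descending_word_closed[OF assms]
  by (simp add: gen_def)

lemma exponent_descending_word: "exponent p (descending_word k) = (if 1 \<le> p \<and> p \<le> k then 1 else 0)"
  by (induction k) auto

context
  fixes n :: nat
  assumes n: "n \<ge> 1"
begin

interpretation F: group "matrix_grading_group n"
  by (rule group_free_group)

lemma descending_word_closed': "i \<in> {1..n} \<Longrightarrow> descending_word (i - 1) \<in> carrier (matrix_grading_group n)"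
  using n by (intro descending_word_closed) auto

lemma unit_degree_closed:
  "i \<in> {1..n} \<Longrightarrow> j \<in> {1..n} \<Longrightarrow> unit_degree n j i \<in> carrier (matrix_grading_group n)"
  by (simp add: unit_degree_def descending_word_closed')

lemma unit_degree_self: "i \<in> {1..n} \<Longrightarrow> unit_degree n i i = \<one>\<^bsub>matrix_grading_group n\<^esub>"
  by (simp add: unit_degree_def descending_word_closed')

lemma unit_degree_mult:
  assumes "i \<in> {1..n}" "j \<in> {1..n}" "l \<in> {1..n}"
  shows "unit_degree n l j \<otimes>\<^bsub>matrix_grading_group n\<^esub> unit_degree n j i = unit_degree n l i"
proof -
  note closed = assms[THEN descending_word_closed']
  have "inv\<^bsub>matrix_grading_group n\<^esub> (descending_word (j - 1)) \<otimes>\<^bsub>matrix_grading_group n\<^esub>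
      (descending_word (j - 1) \<otimes>\<^bsub>matrix_grading_group n\<^esub>
      inv\<^bsub>matrix_grading_group n\<^esub> (descending_word (i - 1))) =
      inv\<^bsub>matrix_grading_group n\<^esub> (descending_word (i - 1))"
    using closed by (simp add: F.m_assoc[symmetric])
  then show ?thesis using closed by (simp add: unit_degree_def F.m_assoc)
qed

lemma unit_degree_swap:
  assumes "i \<in> {1..n}" "j \<in> {1..n}"
  shows "unit_degree n i j = inv\<^bsub>matrix_grading_group n\<^esub> (unit_degree n j i)"
  using unit_degree_mult[of j i j] unit_degree_mult[of i j i] assms
  by (intro F.inv_equality[symmetric]) (auto simp: unit_degree_self unit_degree_closed)

lemma unit_degree_Suc:
  assumes "i \<in> {1..n - 1}"
  shows "unit_degree n (i + 1) i = gen i"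
proof -
  obtain k where k: "i = Suc k" using assms by (cases i) auto
  have "descending_word k \<in> carrier (matrix_grading_group n)" "Suc k < n"
    using descending_word_closed[of k n] k assms by auto
  moreover have "gen i \<in> carrier (matrix_grading_group n)" using assms by (rule gen_mem_free_group)
  ultimately show ?thesis
    using k by (simp only: unit_degree_def k add_diff_cancel_right' diff_Suc_1 descending_word_Suc)
      (simp add: F.m_assoc)
qed

lemma unit_degree_Suc':
  assumes "i \<in> {1..n - 1}"
  shows "unit_degree n i (i + 1) = inv\<^bsub>matrix_grading_group n\<^esub> (gen i)"
  using unit_degree_swap[of "i + 1" i] unit_degree_Suc[OF assms] assms
    unit_degree_swap[of i "i + 1"] by auto

lemma exponent_unit_degree:
  assumes "i \<in> {1..n}" "j \<in> {1..n}"
  shows "exponent p (unit_degree n j i) =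
    (if 1 \<le> p \<and> p < j then 1 else 0) - (if 1 \<le> p \<and> p < i then 1 else 0)"
  using assms
  by (auto simp: unit_degree_def exponent_mult exponent_inv descending_word_closed'
      exponent_descending_word)

text \<open>The exponents of the degree are the difference of the indicator functions of the letters below
  \<open>j\<close> and below \<open>i\<close>, which determines \<open>j\<close> and \<open>i\<close> unless they are equal: all diagonal units
  have trivial degree.  For \<open>n = 1\<close> the only matrix unit is diagonal, but alone in its degree.\<close>

lemma unit_degree_inj:
  assumes ij: "i \<in> {1..n}" "j \<in> {1..n}" and lm: "l \<in> {1..n}" "m \<in> {1..n}"
    and ne: "j \<noteq> i \<or> n = 1" and eq: "unit_degree n l m = unit_degree n j i"
  shows "l = j \<and> m = i"
proof (cases "n = 1")
  case False
  have e: "(if 1 \<le> p \<and> p < l then 1 else 0) - (if 1 \<le> p \<and> p < m then 1 else 0) =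
      ((if 1 \<le> p \<and> p < j then 1 else 0) - (if 1 \<le> p \<and> p < i then 1 else 0) :: int)" for p
    using exponent_unit_degree[OF ij, of p] exponent_unit_degree[OF lm(2,1), of p] eq by simp
  show ?thesis
    \<comment> \<open>The difference of the indicator functions changes value only at \<open>i\<close> and \<open>j\<close>.\<close>
    using e[of i] e[of j] e[of "i - 1"] e[of "j - 1"] ij lm ne False
    by (auto split: if_splits)
qed (use ij lm in auto)

end

text \<open>The principle behind all statements "determined by multiplicativity": off-diagonal matrix
  units are products of sub- and superdiagonal ones.\<close>

lemma pairs_from_neighbours:
  assumes refl: "\<And>i. i \<in> {1..n} \<Longrightarrow> P i i"
    and up: "\<And>i. i \<in> {1..n - 1} \<Longrightarrow> P (i + 1) i"
    and down: "\<And>i. i \<in> {1..n - 1} \<Longrightarrow> P i (i + 1)"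
    and trans: "\<And>i j l. i \<in> {1..n} \<Longrightarrow> j \<in> {1..n} \<Longrightarrow> l \<in> {1..n} \<Longrightarrow> P l j \<Longrightarrow> P j i \<Longrightarrow> P l i"
    and ij: "i \<in> {1..n::nat}" "j \<in> {1..n}"
  shows "P j i"
proof -
  have "P (a + k) a \<and> P a (a + k)" if "a \<in> {1..n}" "a + k \<in> {1..n}" for a k
    using that
  proof (induction k)
    case (Suc k)
    have "P (a + Suc k) (a + k)" "P (a + k) (a + Suc k)"
      using up[of "a + k"] down[of "a + k"] Suc.prems by (auto simp: One_nat_def)
    with Suc show ?case
      using trans[of a "a + k" "a + Suc k"] trans[of "a + Suc k" "a + k" a] by auto
  qed (simp add: refl)
  from this[of i "j - i"] this[of j "i - j"] ij show ?thesis
    by (cases "i \<le> j") auto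
qed

section \<open>The grading of the matrix algebra exists\<close>

definition matrix_component :: "nat \<Rightarrow> (nat \<times> bool) list \<Rightarrow> unit \<Rightarrow> unit \<Rightarrow> 'k::field mat set" where
  "matrix_component n s x y = {A \<in> carrier_mat n n.
     \<forall>a<n. \<forall>b<n. A $$ (a, b) \<noteq> 0 \<longrightarrow> unit_degree n (Suc a) (Suc b) = s}"

lemma index_finsum_module_mat:
  assumes "finite S" "\<And>s. s \<in> S \<Longrightarrow> c s \<in> carrier_mat nr nc" "a < nr" "b < nc"
  shows "(\<Oplus>\<^bsub>module_mat TYPE('k::field) nr nc\<^esub>s\<in>S. c s) $$ (a, b) = (\<Sum>s\<in>S. c s $$ (a, b))"
  using assms(1,2)
proof (induction S rule: finite_induct)
  case empty
  interpret abelian_group "module_mat TYPE('k) nr nc" by (rule abelian_group_mat)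
  show ?case using assms(3,4) by (simp add: module_mat_simps)
next
  case (insert s S)
  interpret abelian_group "module_mat TYPE('k) nr nc" by (rule abelian_group_mat)
  have "c \<in> S \<rightarrow> carrier (module_mat TYPE('k) nr nc)" "c s \<in> carrier (module_mat TYPE('k) nr nc)"
    using insert.prems by (auto simp: module_mat_simps)
  moreover from finsum_closed[OF this(1)]
  have "(\<Oplus>\<^bsub>module_mat TYPE('k) nr nc\<^esub>s\<in>S. c s) \<in> carrier_mat nr nc"
    by (simp add: module_mat_simps)
  ultimately show ?case
    using insert assms(3,4) by (simp add: finsum_insert module_mat_simps)
qed

lemma subspace_matrix_component:
  "subspace class_ring (matrix_component n s x y) (module_mat TYPE('k::field) n n)"
proof -
  have add: "A + B \<in> matrix_component n s x y"
    if AB: "A \<in> matrix_component n s x y" "B \<in> matrix_component n s x y" for A B :: "'k mat"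
  proof -
    have carrier: "A \<in> carrier_mat n n" "B \<in> carrier_mat n n"
      using AB by (simp_all add: matrix_component_def)
    have "unit_degree n (Suc a) (Suc b) = s"
      if ab: "a < n" "b < n" and nz: "(A + B) $$ (a, b) \<noteq> 0" for a b
    proof (cases "A $$ (a, b) = 0")
      case True
      then have "B $$ (a, b) \<noteq> 0" using nz ab carrier by simp
      then show ?thesis using AB ab by (simp add: matrix_component_def)
    qed (use AB ab in \<open>simp add: matrix_component_def\<close>)
    then show ?thesis using carrier by (simp add: matrix_component_def)
  qed
  have "submodule class_ring (matrix_component n s x y) (module_mat TYPE('k) n n)"
    unfolding submodule_def module_mat_simps
  proof (intro conjI allI impI)
    show "module (class_ring :: 'k ring) (module_mat TYPE('k) n n)"
      using matrix_vs by (rule vectorspace.axioms(1))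
    show "matrix_component n s x y \<subseteq> carrier_mat n n" by (auto simp: matrix_component_def)
    show "0\<^sub>m n n \<in> matrix_component n s x y" by (simp add: matrix_component_def)
    show "c \<cdot>\<^sub>m A \<in> matrix_component n s x y" if "A \<in> matrix_component n s x y" for c and A :: "'k mat"
    proof -
      have "A \<in> carrier_mat n n" using that by (simp add: matrix_component_def)
      then show ?thesis using that by (simp add: matrix_component_def)
    qed
  qed (rule add)
  then show ?thesis by (rule subspace.intro[OF matrix_vs])
qed

text \<open>Each entry belongs to exactly one degree, so the component of degree \<open>s\<close> must be the matrix
  restricted to the entries of degree \<open>s\<close>.\<close>

lemma direct_sum_matrix_component:
  assumes n: "n \<ge> 1"
  shows "internal_direct_sum (module_mat TYPE('k::field) n n) (carrier (matrix_grading_group n))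
    (\<lambda>s. matrix_component n s x y)"
  unfolding internal_direct_sum_def module_mat_simps
proof (intro conjI ballI)
  show "subspace class_ring (matrix_component n s x y) (module_mat TYPE('k) n n)" for s
    by (rule subspace_matrix_component)
next
  fix A :: "'k mat" assume A: "A \<in> carrier_mat n n"
  let ?F = "carrier (matrix_grading_group n)"
  let ?deg = "\<lambda>a b. unit_degree n (Suc a) (Suc b)"
  let ?supp = "\<lambda>c :: _ \<Rightarrow> 'k mat. {s. c s \<noteq> 0\<^sub>m n n}"
  let ?P = "\<lambda>c. finite (?supp c) \<and> A = (\<Oplus>\<^bsub>module_mat TYPE('k) n n\<^esub>s\<in>?supp c. c s) \<and>
    (\<forall>s\<in>?F. c s \<in> matrix_component n s x y) \<and> (\<forall>s. s \<notin> ?F \<longrightarrow> c s = 0\<^sub>m n n)"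
  define c where "c = (\<lambda>s. mat n n (\<lambda>(a, b). if ?deg a b = s then A $$ (a, b) else 0))"
  have deg: "?deg a b \<in> ?F" if "a < n" "b < n" for a b
    using that n by (intro unit_degree_closed) auto
  have c_eq: "c s = 0\<^sub>m n n" if "s \<notin> ?F" for s
    using deg that by (intro eq_matI) (auto simp: c_def)
  have sum_supp: "(\<Oplus>\<^bsub>module_mat TYPE('k) n n\<^esub>s\<in>?supp c. c s) $$ (a, b) = c (?deg a b) $$ (a, b)"
    if c: "finite (?supp c)" "\<And>s. c s \<in> matrix_component n s x y" and ab: "a < n" "b < n" for c a b
  proof -
    have "(\<Oplus>\<^bsub>module_mat TYPE('k) n n\<^esub>s\<in>?supp c. c s) $$ (a, b) = (\<Sum>s\<in>?supp c. c s $$ (a, b))"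
      using c ab by (intro index_finsum_module_mat) (auto simp: matrix_component_def)
    also have "\<dots> = (\<Sum>s\<in>?supp c. if s = ?deg a b then c s $$ (a, b) else 0)"
      using c(2) ab by (intro sum.cong) (auto simp: matrix_component_def)
    also have "\<dots> = c (?deg a b) $$ (a, b)"
      using c(1) ab by auto
    finally show ?thesis .
  qed
  have zero: "0\<^sub>m n n \<in> matrix_component n s x y" for s
    by (auto simp: matrix_component_def)
  show "\<exists>!c. ?P c"
  proof (intro ex1I[of _ c])
    have "?supp c \<subseteq> (\<lambda>(a, b). ?deg a b) ` ({..<n} \<times> {..<n})"
    proof
      fix s assume "s \<in> ?supp c"
      then have "\<exists>a<n. \<exists>b<n. c s $$ (a, b) \<noteq> 0"
        by (auto simp: c_def intro!: eq_matI)
      then show "s \<in> (\<lambda>(a, b). ?deg a b) ` ({..<n} \<times> {..<n})"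
        by (force simp: c_def split: if_splits)
    qed
    then have fin: "finite (?supp c)" by (rule finite_subset) simp
    have comp: "c s \<in> matrix_component n s x y" for s
      by (auto simp: matrix_component_def c_def)
    have entry: "c (?deg a b) $$ (a, b) = A $$ (a, b)" if "a < n" "b < n" for a b
      using that by (simp add: c_def)
    interpret abelian_group "module_mat TYPE('k) n n" by (rule abelian_group_mat)
    have "(\<Oplus>\<^bsub>module_mat TYPE('k) n n\<^esub>s\<in>?supp c. c s) \<in> carrier (module_mat TYPE('k) n n)"
      using comp by (intro finsum_closed) (auto simp: matrix_component_def module_mat_simps)
    then have "A = (\<Oplus>\<^bsub>module_mat TYPE('k) n n\<^esub>s\<in>?supp c. c s)"
      using A entry by (intro eq_matI) (auto simp: module_mat_simps sum_supp[OF fin comp])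
    then show "?P c" using fin comp c_eq by blast
  next
    fix c' assume c': "?P c'"
    then have comp: "c' s \<in> matrix_component n s x y" for s
      using zero by (cases "s \<in> ?F") auto
    have carrier: "c' s \<in> carrier_mat n n" for s
      using comp[of s] by (simp add: matrix_component_def)
    have off: "c' s $$ (a, b) = 0" if "a < n" "b < n" "s \<noteq> ?deg a b" for s a b
      using comp[of s] that unfolding matrix_component_def by blast
    have on: "c' (?deg a b) $$ (a, b) = A $$ (a, b)" if "a < n" "b < n" for a b
      using sum_supp[of c' a b, OF _ comp that] c' by metis
    have "c' s $$ (a, b) = c s $$ (a, b)" if "a < n" "b < n" for s a b
      using off[OF that] on[OF that] that by (cases "s = ?deg a b") (simp_all add: c_def)
    then show "c' = c"
      using carrier_matD[OF carrier] by (intro ext eq_matI) (simp_all add: c_def)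
  qed
qed

lemma matrix_component_mult:
  assumes n: "n \<ge> 1" and A: "A \<in> matrix_component n s x y" and B: "B \<in> matrix_component n t y z"
  shows "B * A \<in> matrix_component n (t \<otimes>\<^bsub>matrix_grading_group n\<^esub> s) x z"
proof -
  have "unit_degree n (Suc a) (Suc b) = t \<otimes>\<^bsub>matrix_grading_group n\<^esub> s"
    if ab: "a < n" "b < n" and nz: "(B * A) $$ (a, b) \<noteq> 0" for a b
  proof -
    have "(B * A) $$ (a, b) = (\<Sum>k<n. B $$ (a, k) * A $$ (k, b))"
      using A B ab by (auto simp: matrix_component_def scalar_prod_def lessThan_atLeast0 intro!: sum.cong)
    then have "(\<Sum>k<n. B $$ (a, k) * A $$ (k, b)) \<noteq> 0" using nz by simp
    then obtain k where k: "k < n" "B $$ (a, k) \<noteq> 0" "A $$ (k, b) \<noteq> 0"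
      by (rule sum.not_neutral_contains_not_neutral) auto
    then have "unit_degree n (Suc a) (Suc k) = t" "unit_degree n (Suc k) (Suc b) = s"
      using A B ab by (auto simp: matrix_component_def)
    then show ?thesis
      using unit_degree_mult[OF n, of "Suc b" "Suc k" "Suc a"] ab k by auto
  qed
  then show ?thesis using A B by (auto simp: matrix_component_def)
qed

lemma matrix_unit_grading_exists:
  assumes n: "n \<ge> 1"
  shows "is_matrix_unit_grading TYPE('k::field) n (matrix_component n)"
proof -
  have unit: "matrix_unit n j i \<in> matrix_component n (unit_degree n j i) () ()" for i j
    by (auto simp: matrix_component_def index_matrix_unit)
  have "is_grading (matrix_grading_group n) (matrix_component n) (matrix_kcat TYPE('k) n)"
    unfolding is_grading_def
    using group_free_group k_category_matrix_kcat direct_sum_matrix_component[OF n]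
    by (auto simp: matrix_kcat_simps intro!: matrix_component_mult[OF n])
  moreover have "matrix_unit n i i \<in> matrix_component n \<one>\<^bsub>matrix_grading_group n\<^esub> () ()"
    if "i \<in> {1..n}" for i
    using unit[of i i] unit_degree_self[OF n that] by simp
  moreover have "matrix_unit n (i + 1) i \<in> matrix_component n (gen i) () ()"
    "matrix_unit n i (i + 1) \<in> matrix_component n (inv\<^bsub>matrix_grading_group n\<^esub> (gen i)) () ()"
    if "i \<in> {1..n - 1}" for i
    using unit[of "i + 1" i] unit[of i "i + 1"] unit_degree_Suc[OF n that] unit_degree_Suc'[OF n that]
    by simp_all
  ultimately show ?thesis
    unfolding is_matrix_unit_grading_def using unit unit_degree_closed[OF n] by blast
qed

section \<open>The components of a matrix unit grading\<close>

context
  fixes n :: nat and X :: "(nat \<times> bool) list \<Rightarrow> unit \<Rightarrow> unit \<Rightarrow> 'k::field mat set"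
  assumes n: "n \<ge> 1" and X: "is_matrix_unit_grading TYPE('k) n X"
begin

interpretation F: group "matrix_grading_group n"
  by (rule group_free_group)

lemma matrix_unit_grading_is_grading:
  "is_grading (matrix_grading_group n) X (matrix_kcat TYPE('k) n)"
  using X by (simp add: is_matrix_unit_grading_def)

lemma component_subspace:
  "s \<in> carrier (matrix_grading_group n) \<Longrightarrow>
    subspace class_ring (X s () ()) (module_mat TYPE('k) n n)"
  using grading_subspace[OF matrix_unit_grading_is_grading, of "()" "()" s]
  by (simp add: matrix_kcat_simps)

lemma component_mult:
  "s \<in> carrier (matrix_grading_group n) \<Longrightarrow> t \<in> carrier (matrix_grading_group n) \<Longrightarrow>
    A \<in> X s () () \<Longrightarrow> B \<in> X t () () \<Longrightarrow> B * A \<in> X (t \<otimes>\<^bsub>matrix_grading_group n\<^esub> s) () ()"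
  using grading_comp[OF matrix_unit_grading_is_grading, of "()" "()" "()" s t A B]
  by (simp add: matrix_kcat_simps)

lemma component_degree_unique:
  "s \<in> carrier (matrix_grading_group n) \<Longrightarrow> t \<in> carrier (matrix_grading_group n) \<Longrightarrow>
    A \<in> X s () () \<Longrightarrow> A \<in> X t () () \<Longrightarrow> A \<noteq> 0\<^sub>m n n \<Longrightarrow> s = t"
  using grading_degree_unique[OF matrix_unit_grading_is_grading, of "()" "()" s t A]
  by (simp add: matrix_kcat_simps module_mat_simps)

lemma component_carrier:
  "s \<in> carrier (matrix_grading_group n) \<Longrightarrow> A \<in> X s () () \<Longrightarrow> A \<in> carrier_mat n n"
  using subspace_subset[OF component_subspace[of s]] by (auto simp: module_mat_simps)

lemma matrix_unit_in_component:
  assumes "i \<in> {1..n}" "j \<in> {1..n}"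
  shows "matrix_unit n j i \<in> X (unit_degree n j i) () ()"
proof (rule pairs_from_neighbours[where P = "\<lambda>j i. matrix_unit n j i \<in> X (unit_degree n j i) () ()",
      OF _ _ _ _ assms])
  show "matrix_unit n i i \<in> X (unit_degree n i i) () ()" if "i \<in> {1..n}" for i
    using X that by (simp add: is_matrix_unit_grading_def unit_degree_self[OF n that])
  show "matrix_unit n (i + 1) i \<in> X (unit_degree n (i + 1) i) () ()" if "i \<in> {1..n - 1}" for i
    using X that unit_degree_Suc[OF n that] by (simp add: is_matrix_unit_grading_def)
  show "matrix_unit n i (i + 1) \<in> X (unit_degree n i (i + 1)) () ()" if "i \<in> {1..n - 1}" for i
    using X that unit_degree_Suc'[OF n that] by (simp add: is_matrix_unit_grading_def)
next
  fix i j l assume ijl: "i \<in> {1..n}" "j \<in> {1..n}" "l \<in> {1..n}"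
    and "matrix_unit n l j \<in> X (unit_degree n l j) () ()"
    and "matrix_unit n j i \<in> X (unit_degree n j i) () ()"
  then have "matrix_unit n l j * matrix_unit n j i \<in>
      X (unit_degree n l j \<otimes>\<^bsub>matrix_grading_group n\<^esub> unit_degree n j i) () ()"
    by (intro component_mult unit_degree_closed[OF n])
  then show "matrix_unit n l i \<in> X (unit_degree n l i) () ()"
    by (simp add: matrix_unit_mult[OF ijl(2)] unit_degree_mult[OF n ijl])
qed

text \<open>The identity is the sum of the diagonal units; the sum is taken one unit at a time.\<close>

lemma identity_in_component: "1\<^sub>m n \<in> X \<one>\<^bsub>matrix_grading_group n\<^esub> () ()"
proof -
  define partial_identity :: "nat \<Rightarrow> 'k mat"
    where "partial_identity = (\<lambda>m. mat n n (\<lambda>(a, b). if a = b \<and> a < m then 1 else 0))"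
  note sub = component_subspace[OF F.one_closed]
  have "m \<le> n \<Longrightarrow> partial_identity m \<in> X \<one>\<^bsub>matrix_grading_group n\<^esub> () ()" for m
  proof (induction m)
    case 0
    have "partial_identity 0 = 0\<^sub>m n n" by (intro eq_matI) (auto simp: partial_identity_def)
    then show ?case using subspace_zero[OF sub] by (simp add: module_mat_simps)
  next
    case (Suc m)
    have "partial_identity (Suc m) = partial_identity m + matrix_unit n (Suc m) (Suc m)"
      by (intro eq_matI) (auto simp: partial_identity_def index_matrix_unit)
    moreover have "matrix_unit n (Suc m) (Suc m) \<in> X \<one>\<^bsub>matrix_grading_group n\<^esub> () ()"
      using matrix_unit_in_component[of "Suc m" "Suc m"] unit_degree_self[OF n, of "Suc m"] Suc.prems
      by simp
    ultimately show ?case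
      using Suc subspace_add[OF sub, of "partial_identity m"] by (simp add: module_mat_simps)
  qed
  moreover have "partial_identity n = 1\<^sub>m n" by (intro eq_matI) (auto simp: partial_identity_def)
  ultimately show ?thesis by (metis order_refl)
qed

text \<open>Multiplying by diagonal units, which have trivial degree, cuts out a single entry without
  changing the degree.\<close>

lemma unit_degree_of_entry:
  assumes s: "s \<in> carrier (matrix_grading_group n)" "A \<in> X s () ()"
    and ij: "i \<in> {1..n}" "j \<in> {1..n}" and nz: "A $$ (j - 1, i - 1) \<noteq> 0"
  shows "unit_degree n j i = s"
proof -
  define a where "a = A $$ (j - 1, i - 1)"
  have diag: "matrix_unit n i i \<in> X \<one>\<^bsub>matrix_grading_group n\<^esub> () ()" if "i \<in> {1..n}" for i
    using matrix_unit_in_component[OF that that] unit_degree_self[OF n that] by simp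
  have "matrix_unit n j j * (A * matrix_unit n i i) \<in>
      X (\<one>\<^bsub>matrix_grading_group n\<^esub> \<otimes>\<^bsub>matrix_grading_group n\<^esub>
        (s \<otimes>\<^bsub>matrix_grading_group n\<^esub> \<one>\<^bsub>matrix_grading_group n\<^esub>)) () ()"
    using diag ij s by (intro component_mult F.m_closed F.one_closed)
  then have "a \<cdot>\<^sub>m matrix_unit n j i \<in> X s () ()"
    using s by (simp add: matrix_unit_compress[OF component_carrier[OF s] ij] a_def)
  then have "inverse a \<cdot>\<^sub>m (a \<cdot>\<^sub>m matrix_unit n j i) \<in> X s () ()"
    using subspace_smult[OF component_subspace[OF s(1)], of _ "inverse a"]
    by (simp add: module_mat_simps)
  moreover have "inverse a \<cdot>\<^sub>m (a \<cdot>\<^sub>m matrix_unit n j i) = matrix_unit n j i"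
    using nz by (intro eq_matI) (auto simp: a_def)
  ultimately have "matrix_unit n j i \<in> X s () ()" by simp
  then show ?thesis
    using component_degree_unique[OF unit_degree_closed[OF n ij] s(1) matrix_unit_in_component[OF ij]]
    by (simp add: matrix_unit_nonzero[OF ij])
qed

text \<open>By \<open>unit_degree_of_entry\<close> only entries of the given degree can be non-zero, and there is just
  one of them.\<close>

lemma component_one_dimensional:
  assumes ij: "i \<in> {1..n}" "j \<in> {1..n}" and ne: "j \<noteq> i \<or> n = 1"
    and A: "A \<in> X (unit_degree n j i) () ()"
  shows "A = A $$ (j - 1, i - 1) \<cdot>\<^sub>m matrix_unit n j i"
proof -
  note deg = unit_degree_closed[OF n ij]
  have A': "A \<in> carrier_mat n n" using component_carrier[OF deg A] .
  have off: "A $$ (a, b) = 0" if ab: "a < n" "b < n" and ne': "\<not> (Suc a = j \<and> Suc b = i)" for a b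
  proof (rule ccontr)
    assume nz: "A $$ (a, b) \<noteq> 0"
    have ab': "Suc a \<in> {1..n}" "Suc b \<in> {1..n}" using ab by auto
    have "unit_degree n (Suc a) (Suc b) = unit_degree n j i"
      using unit_degree_of_entry[OF deg A ab'(2,1)] nz by simp
    then show False using unit_degree_inj[OF n ij ab' ne] ne' by blast
  qed
  have "A $$ (a, b) = (A $$ (j - 1, i - 1) \<cdot>\<^sub>m matrix_unit n j i) $$ (a, b)"
    if "a < n" "b < n" for a b
    using off[OF that] that by (cases "Suc a = j \<and> Suc b = i") (auto simp: index_matrix_unit)
  then show ?thesis
    using carrier_matD[OF A'] by (intro eq_matI) simp_all
qed

section \<open>The grading is connected\<close>

text \<open>A reduced word is spelled by a walk of sub- and superdiagonal units, one for each letter.  The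
  walk ends with a diagonal unit of trivial degree, since walks are non-empty.\<close>

lemma connected_matrix_unit_grading:
  "connected_grading (matrix_grading_group n) X (matrix_kcat TYPE('k) n)"
proof -
  note gr = matrix_unit_grading_is_grading
  have nonzero: "nonzero_mor (matrix_kcat TYPE('k) n) () () (matrix_unit n j i)"
    if "i \<in> {1..n}" "j \<in> {1..n}" for i j
    by (simp add: nonzero_mor_def matrix_kcat_simps module_mat_simps matrix_unit_nonzero[OF that])
  have degree: "degree_of (matrix_grading_group n) X () () (matrix_unit n j i) = unit_degree n j i"
    if "i \<in> {1..n}" "j \<in> {1..n}" for i j
    using degree_of_eq[OF gr nonzero[OF that] unit_degree_closed[OF n that] matrix_unit_in_component[OF that]] .
  have homogeneous: "homogeneous (matrix_grading_group n) X (Fwd () () (matrix_unit n j i))"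
    if "i \<in> {1..n}" "j \<in> {1..n}" for i j
    using matrix_unit_in_component[OF that] unit_degree_closed[OF n that] by auto
  have "\<exists>w. nonzero_walk (matrix_kcat TYPE('k) n) () w () \<and>
      (\<forall>v\<in>set w. homogeneous (matrix_grading_group n) X v) \<and> walk_degree (matrix_grading_group n) X w = s"
    if "s \<in> carrier (matrix_grading_group n)" for s
    using that
  proof (induction s)
    case Nil
    have one: "1 \<in> {1..n}" using n by simp
    then show ?case
      using nonzero[OF one one] homogeneous[OF one one]
      by (intro exI[of _ "[Fwd () () (matrix_unit n 1 1)]"])
        (simp add: nonzero_walk_def degree[OF one one] unit_degree_self[OF n] mult_free_group one_free_group)
  next
    case (Cons p s)
    obtain i b where p: "p = (i, b)" by (cases p)
    have i: "i \<in> {1..n - 1}" and s: "s \<in> carrier (matrix_grading_group n)"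
      using Cons_mem_free_group[OF Cons.prems] p by auto
    then have ii: "i \<in> {1..n}" "i + 1 \<in> {1..n}" by auto
    obtain w where w: "nonzero_walk (matrix_kcat TYPE('k) n) () w ()"
      "\<forall>v\<in>set w. homogeneous (matrix_grading_group n) X v" "walk_degree (matrix_grading_group n) X w = s"
      using Cons.IH[OF s] by blast
    define u :: "(unit, 'k mat) signed_mor"
      where "u = Fwd () () (if b then matrix_unit n (i + 1) i else matrix_unit n i (i + 1))"
    have "nonzero_signed_mor (matrix_kcat TYPE('k) n) u" "homogeneous (matrix_grading_group n) X u"
      using nonzero[OF ii] nonzero[OF ii(2,1)] homogeneous[OF ii] homogeneous[OF ii(2,1)]
      by (auto simp only: u_def nonzero_signed_mor.simps split: if_splits)
    moreover have "walk_degree (matrix_grading_group n) X (u # w) = p # s"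
      using degree[OF ii] degree[OF ii(2,1)] unit_degree_Suc[OF n i] unit_degree_Suc'[OF n i]
        inv_gen[OF i] Cons_eq_mult_free_group[OF Cons.prems] w(3)
      by (cases b) (simp_all add: u_def p gen_def)
    ultimately show ?case
      using w by (intro exI[of _ "u # w"]) (auto simp: nonzero_walk_def successively_Cons)
  qed
  then show ?thesis using gr by (simp add: connected_grading_def matrix_kcat_simps)
qed

section \<open>Gradings of the smash product\<close>

context
  fixes D :: "'d monoid" and Y
  assumes Y: "is_grading D Y (smash (matrix_kcat TYPE('k) n) (matrix_grading_group n) X)"
begin

abbreviation "covering \<equiv> smash (matrix_kcat TYPE('k) n) (matrix_grading_group n) X"

interpretation D: group D
  by (rule grading_group[OF Y])

text \<open>Passing to inverses matches the smash product with the Cayley graph: as an object, the vertex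
  \<open>w\<close> has the inverse of \<open>w\<close> as its group component, and then a morphism of degree \<open>u\<close> starting at
  the vertex \<open>w\<close> ends at \<open>u \<otimes> w\<close>.\<close>

abbreviation vertex :: "(nat \<times> bool) list \<Rightarrow> unit \<times> (nat \<times> bool) list" where
  "vertex w \<equiv> ((), inv\<^bsub>matrix_grading_group n\<^esub> w)"

abbreviation shift :: "nat \<Rightarrow> nat \<Rightarrow> (nat \<times> bool) list \<Rightarrow> (nat \<times> bool) list" where
  "shift j i w \<equiv> unit_degree n j i \<otimes>\<^bsub>matrix_grading_group n\<^esub> w"

lemma vertex_Obj: "w \<in> carrier (matrix_grading_group n) \<Longrightarrow> vertex w \<in> Obj covering"
  by (simp add: Obj_smash matrix_kcat_simps)

lemma hom_vertex:
  assumes "w \<in> carrier (matrix_grading_group n)" "v \<in> carrier (matrix_grading_group n)"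
  shows "carrier (Hom covering (vertex w) (vertex v)) =
      X (v \<otimes>\<^bsub>matrix_grading_group n\<^esub> inv\<^bsub>matrix_grading_group n\<^esub> w) () ()"
    and "\<zero>\<^bsub>Hom covering (vertex w) (vertex v)\<^esub> = 0\<^sub>m n n"
    and "a \<odot>\<^bsub>Hom covering (vertex w) (vertex v)\<^esub> f = a \<cdot>\<^sub>m f"
  using assms by (simp_all add: Hom_smash matrix_kcat_simps module_mat_simps)

lemma smash_component_mult:
  assumes "u \<in> carrier (matrix_grading_group n)" "v \<in> carrier (matrix_grading_group n)"
    "w \<in> carrier (matrix_grading_group n)" "s \<in> carrier D" "t \<in> carrier D"
    "f \<in> Y s (vertex u) (vertex v)" "g \<in> Y t (vertex v) (vertex w)"
  shows "g * f \<in> Y (t \<otimes>\<^bsub>D\<^esub> s) (vertex u) (vertex w)"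
  using grading_comp[OF Y vertex_Obj vertex_Obj vertex_Obj, of u v w s t f g] assms
  by (simp add: Comp_smash matrix_kcat_simps)

lemma matrix_unit_homogeneous:
  assumes ij: "i \<in> {1..n}" "j \<in> {1..n}" and ne: "j \<noteq> i \<or> n = 1"
    and w: "w \<in> carrier (matrix_grading_group n)"
  shows "\<exists>s\<in>carrier D. matrix_unit n j i \<in> Y s (vertex w) (vertex (shift j i w))"
proof -
  define v where "v = shift j i w"
  note deg = unit_degree_closed[OF n ij]
  have v: "v \<in> carrier (matrix_grading_group n)" using deg w by (simp add: v_def)
  have "v \<otimes>\<^bsub>matrix_grading_group n\<^esub> inv\<^bsub>matrix_grading_group n\<^esub> w = unit_degree n j i"
    using deg w by (simp add: v_def F.m_assoc)
  then have carrier: "carrier (Hom covering (vertex w) (vertex v)) = X (unit_degree n j i) () ()"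
    using hom_vertex(1)[OF w v] by simp
  have span: "\<exists>a. A = a \<odot>\<^bsub>Hom covering (vertex w) (vertex v)\<^esub> matrix_unit n j i"
    if "A \<in> carrier (Hom covering (vertex w) (vertex v))" for A
    using component_one_dimensional[OF ij ne, of A] that
    unfolding carrier hom_vertex(3)[OF w v] by blast
  have mem: "matrix_unit n j i \<in> carrier (Hom covering (vertex w) (vertex v))"
    using matrix_unit_in_component[OF ij] carrier by simp
  have nz: "matrix_unit n j i \<noteq> \<zero>\<^bsub>Hom covering (vertex w) (vertex v)\<^esub>"
    by (simp only: hom_vertex(2)[OF w v] matrix_unit_nonzero[OF ij] not_False_eq_True)
  show ?thesis
    unfolding v_def[symmetric]
    by (rule direct_sum_one_dimensional[OF grading_hom_vectorspace[OF Y vertex_Obj[OF w] vertex_Obj[OF v]]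
        grading_direct_sum[OF Y vertex_Obj[OF w] vertex_Obj[OF v]] mem nz span])
qed

lemma shift_closed:
  "i \<in> {1..n} \<Longrightarrow> j \<in> {1..n} \<Longrightarrow> w \<in> carrier (matrix_grading_group n) \<Longrightarrow>
    shift j i w \<in> carrier (matrix_grading_group n)"
  using unit_degree_closed[OF n] by simp

lemma shift_shift:
  assumes "i \<in> {1..n}" "j \<in> {1..n}" "l \<in> {1..n}" "w \<in> carrier (matrix_grading_group n)"
  shows "shift l j (shift j i w) = shift l i w"
  using assms unit_degree_closed[OF n] unit_degree_mult[OF n assms(1-3)]
  by (simp add: F.m_assoc[symmetric])

lemma shift_self: "i \<in> {1..n} \<Longrightarrow> w \<in> carrier (matrix_grading_group n) \<Longrightarrow> shift i i w = w"
  by (simp add: unit_degree_self[OF n])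

text \<open>A matrix unit and the opposite one have inverse degrees, for their product is an idempotent.\<close>

lemma opposite_degrees:
  assumes ij: "i \<in> {1..n}" "j \<in> {1..n}" and w: "w \<in> carrier (matrix_grading_group n)"
    and st: "s \<in> carrier D" "t \<in> carrier D"
    and s: "matrix_unit n j i \<in> Y s (vertex w) (vertex (shift j i w))"
    and t: "matrix_unit n i j \<in> Y t (vertex (shift j i w)) (vertex w)"
  shows "t \<otimes>\<^bsub>D\<^esub> s = \<one>\<^bsub>D\<^esub>" "matrix_unit n i i \<in> Y \<one>\<^bsub>D\<^esub> (vertex w) (vertex w)"
proof -
  have "matrix_unit n i j * matrix_unit n j i \<in> Y (t \<otimes>\<^bsub>D\<^esub> s) (vertex w) (vertex w)"
    using smash_component_mult[OF w shift_closed[OF ij w] w st s t] .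
  then have mem: "matrix_unit n i i \<in> Y (t \<otimes>\<^bsub>D\<^esub> s) (vertex w) (vertex w)"
    by (simp only: matrix_unit_mult[OF ij(2)])
  moreover have "matrix_unit n i i \<noteq> \<zero>\<^bsub>Hom covering (vertex w) (vertex w)\<^esub>"
    by (simp only: hom_vertex(2)[OF w w] matrix_unit_nonzero[OF ij(1,1)] not_False_eq_True)
  moreover have "Comp covering (vertex w) (vertex w) (vertex w) (matrix_unit n i i) (matrix_unit n i i) =
      matrix_unit n i i"
    by (simp only: Comp_smash matrix_kcat_simps matrix_unit_mult[OF ij(1)])
  ultimately show ts: "t \<otimes>\<^bsub>D\<^esub> s = \<one>\<^bsub>D\<^esub>"
    using idempotent_degree[OF Y vertex_Obj[OF w]] st by simp
  show "matrix_unit n i i \<in> Y \<one>\<^bsub>D\<^esub> (vertex w) (vertex w)" using mem ts by simp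
qed

text \<open>The diagonal unit is the product of two opposite homogeneous units.  For \<open>n = 1\<close> there is no
  index other than \<open>i\<close>, but then the diagonal unit spans its morphism space.\<close>

lemma diagonal_unit_degree:
  assumes i: "i \<in> {1..n}" and w: "w \<in> carrier (matrix_grading_group n)"
  shows "matrix_unit n i i \<in> Y \<one>\<^bsub>D\<^esub> (vertex w) (vertex w)"
proof -
  have "\<exists>j\<in>{1..n}. j \<noteq> i \<or> n = 1"
  proof (cases "n = 1")
    case False
    then have "(if i = 1 then 2 else 1) \<in> {1..n}" "(if i = 1 then 2 else 1) \<noteq> i" using n by auto
    then show ?thesis by blast
  qed (use i in auto)
  then obtain j where j: "j \<in> {1..n}" "j \<noteq> i \<or> n = 1" "i \<noteq> j \<or> n = 1" by auto
  obtain s where s: "s \<in> carrier D" "matrix_unit n j i \<in> Y s (vertex w) (vertex (shift j i w))"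
    using matrix_unit_homogeneous[OF i j(1,2) w] by blast
  obtain t where t: "t \<in> carrier D" "matrix_unit n i j \<in> Y t (vertex (shift j i w)) (vertex w)"
    using matrix_unit_homogeneous[OF j(1) i j(3) shift_closed[OF i j(1) w]]
      shift_shift[OF i j(1) i w] shift_self[OF i w] by auto
  show ?thesis by (rule opposite_degrees(2)[OF i j(1) w s(1) t(1) s(2) t(2)])
qed

text \<open>The potential is built from the subdiagonal units, which are the edges of the Cayley tree, and
  multiplicativity carries it over to the remaining matrix units.\<close>

lemma smash_grading_potential:
  "\<exists>\<psi>. (\<forall>w\<in>carrier (matrix_grading_group n). \<psi> w \<in> carrier D) \<and>
    (\<forall>i\<in>{1..n}. \<forall>j\<in>{1..n}. \<forall>w\<in>carrier (matrix_grading_group n).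
      matrix_unit n j i \<in> Y (\<psi> (shift j i w) \<otimes>\<^bsub>D\<^esub> inv\<^bsub>D\<^esub> (\<psi> w)) (vertex w) (vertex (shift j i w)))"
proof -
  let ?F = "carrier (matrix_grading_group n)"
  have "\<exists>s\<in>carrier D. matrix_unit n (i + 1) i \<in> Y s (vertex w) (vertex (shift (i + 1) i w))"
    if "i \<in> {1..n - 1}" "w \<in> ?F" for i w
    using that by (intro matrix_unit_homogeneous) auto
  then obtain \<delta> where \<delta>: "\<And>i w. i \<in> {1..n - 1} \<Longrightarrow> w \<in> ?F \<Longrightarrow> \<delta> i w \<in> carrier D \<and>
      matrix_unit n (i + 1) i \<in> Y (\<delta> i w) (vertex w) (vertex (shift (i + 1) i w))"
    by metis
  obtain \<psi> where \<psi>: "\<And>w. w \<in> ?F \<Longrightarrow> \<psi> w \<in> carrier D"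
    and \<psi>_gen: "\<And>i w. i \<in> {1..n - 1} \<Longrightarrow> w \<in> ?F \<Longrightarrow>
      \<psi> (gen i \<otimes>\<^bsub>matrix_grading_group n\<^esub> w) = \<delta> i w \<otimes>\<^bsub>D\<^esub> \<psi> w"
    using cayley_tree_potential[OF D.is_group, of "{1..n - 1}" \<delta>] \<delta> by blast
  define P where "P = (\<lambda>j i. \<forall>w\<in>?F. matrix_unit n j i \<in>
    Y (\<psi> (shift j i w) \<otimes>\<^bsub>D\<^esub> inv\<^bsub>D\<^esub> (\<psi> w)) (vertex w) (vertex (shift j i w)))"
  have refl: "P i i" if i: "i \<in> {1..n}" for i
    using diagonal_unit_degree[OF i] shift_self[OF i] \<psi> by (simp add: P_def)
  have up: "P (i + 1) i" if i: "i \<in> {1..n - 1}" for i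
    unfolding P_def
  proof
    fix w assume w: "w \<in> ?F"
    have "\<psi> (shift (i + 1) i w) \<otimes>\<^bsub>D\<^esub> inv\<^bsub>D\<^esub> (\<psi> w) = \<delta> i w"
      using \<psi>_gen[OF i w] \<delta>[OF i w] \<psi>[OF w] unit_degree_Suc[OF n i] by (simp add: D.m_assoc)
    then show "matrix_unit n (i + 1) i \<in> Y (\<psi> (shift (i + 1) i w) \<otimes>\<^bsub>D\<^esub> inv\<^bsub>D\<^esub> (\<psi> w))
        (vertex w) (vertex (shift (i + 1) i w))"
      using \<delta>[OF i w] by simp
  qed
  have down: "P i (i + 1)" if i: "i \<in> {1..n - 1}" for i
    unfolding P_def
  proof
    fix w assume w: "w \<in> ?F"
    have ii: "i \<in> {1..n}" "i + 1 \<in> {1..n}" "i \<noteq> i + 1 \<or> n = 1" using i by auto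
    define v where "v = shift i (i + 1) w"
    have v: "v \<in> ?F" unfolding v_def by (rule shift_closed[OF ii(2,1) w])
    have w_eq: "shift (i + 1) i v = w"
      unfolding v_def using shift_shift[OF ii(2,1,2) w] shift_self[OF ii(2) w] by simp
    obtain t where t: "t \<in> carrier D" "matrix_unit n i (i + 1) \<in> Y t (vertex w) (vertex v)"
      using matrix_unit_homogeneous[OF ii(2,1,3) w] unfolding v_def by blast
    have s: "\<psi> w \<otimes>\<^bsub>D\<^esub> inv\<^bsub>D\<^esub> (\<psi> v) \<in> carrier D"
      "matrix_unit n (i + 1) i \<in> Y (\<psi> w \<otimes>\<^bsub>D\<^esub> inv\<^bsub>D\<^esub> (\<psi> v)) (vertex v) (vertex w)"
      using up[OF i] v w_eq \<psi> w unfolding P_def by auto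
    have "(\<psi> w \<otimes>\<^bsub>D\<^esub> inv\<^bsub>D\<^esub> (\<psi> v)) \<otimes>\<^bsub>D\<^esub> t = \<one>\<^bsub>D\<^esub>"
      using opposite_degrees(1)[OF ii(2,1) w t(1) s(1)] t(2) s(2) unfolding v_def by blast
    then have "t = inv\<^bsub>D\<^esub> (\<psi> w \<otimes>\<^bsub>D\<^esub> inv\<^bsub>D\<^esub> (\<psi> v))"
      using s(1) t(1) D.inv_equality D.inv_inv by metis
    then have "t = \<psi> v \<otimes>\<^bsub>D\<^esub> inv\<^bsub>D\<^esub> (\<psi> w)" using \<psi> v w by (simp add: D.inv_mult_group)
    then show "matrix_unit n i (i + 1) \<in> Y (\<psi> (shift i (i + 1) w) \<otimes>\<^bsub>D\<^esub> inv\<^bsub>D\<^esub> (\<psi> w))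
        (vertex w) (vertex (shift i (i + 1) w))"
      using t(2) by (simp add: v_def)
  qed
  have trans: "P l i" if ijl: "i \<in> {1..n}" "j \<in> {1..n}" "l \<in> {1..n}" and "P l j" "P j i" for i j l
    unfolding P_def
  proof
    fix w assume w: "w \<in> ?F"
    define v where "v = shift j i w"
    have v: "v \<in> ?F" unfolding v_def by (rule shift_closed[OF ijl(1,2) w])
    define u where "u = shift l i w"
    have u: "u \<in> ?F" unfolding u_def by (rule shift_closed[OF ijl(1,3) w])
    have vu: "shift l j v = u" unfolding u_def v_def by (rule shift_shift[OF ijl w])
    have "matrix_unit n j i \<in> Y (\<psi> v \<otimes>\<^bsub>D\<^esub> inv\<^bsub>D\<^esub> (\<psi> w)) (vertex w) (vertex v)"
      "matrix_unit n l j \<in> Y (\<psi> u \<otimes>\<^bsub>D\<^esub> inv\<^bsub>D\<^esub> (\<psi> v)) (vertex v) (vertex u)"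
      using \<open>P l j\<close> \<open>P j i\<close> w v vu unfolding P_def v_def by auto
    then have "matrix_unit n l j * matrix_unit n j i \<in>
        Y ((\<psi> u \<otimes>\<^bsub>D\<^esub> inv\<^bsub>D\<^esub> (\<psi> v)) \<otimes>\<^bsub>D\<^esub> (\<psi> v \<otimes>\<^bsub>D\<^esub> inv\<^bsub>D\<^esub> (\<psi> w))) (vertex w) (vertex u)"
      using \<psi> u v w by (intro smash_component_mult) auto
    moreover have "(\<psi> u \<otimes>\<^bsub>D\<^esub> inv\<^bsub>D\<^esub> (\<psi> v)) \<otimes>\<^bsub>D\<^esub> (\<psi> v \<otimes>\<^bsub>D\<^esub> inv\<^bsub>D\<^esub> (\<psi> w)) = \<psi> u \<otimes>\<^bsub>D\<^esub> inv\<^bsub>D\<^esub> (\<psi> w)"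
    proof -
      have "inv\<^bsub>D\<^esub> (\<psi> v) \<otimes>\<^bsub>D\<^esub> (\<psi> v \<otimes>\<^bsub>D\<^esub> inv\<^bsub>D\<^esub> (\<psi> w)) = inv\<^bsub>D\<^esub> (\<psi> w)"
        using \<psi>[OF v] \<psi>[OF w] by (simp add: D.m_assoc[symmetric])
      then show ?thesis using \<psi>[OF u] \<psi>[OF v] \<psi>[OF w] by (simp add: D.m_assoc)
    qed
    ultimately show "matrix_unit n l i \<in> Y (\<psi> (shift l i w) \<otimes>\<^bsub>D\<^esub> inv\<^bsub>D\<^esub> (\<psi> w))
        (vertex w) (vertex (shift l i w))"
      by (simp only: matrix_unit_mult[OF ijl(2)] u_def)
  qed
  have "P j i" if "i \<in> {1..n}" "j \<in> {1..n}" for i j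
    using refl up down trans that by (rule pairs_from_neighbours)
  then show ?thesis using \<psi> unfolding P_def by blast
qed

text \<open>A non-zero morphism has a non-zero entry; cutting it out with diagonal units, which are of trivial
  \<open>Y\<close>-degree, shows that the morphism has the degree of a matrix unit.\<close>

lemma homogeneous_morphism_degree:
  assumes \<psi>: "\<forall>i\<in>{1..n}. \<forall>j\<in>{1..n}. \<forall>w\<in>carrier (matrix_grading_group n). matrix_unit n j i \<in>
      Y (\<psi> (shift j i w) \<otimes>\<^bsub>D\<^esub> inv\<^bsub>D\<^esub> (\<psi> w)) (vertex w) (vertex (shift j i w))"
    and \<psi>_closed: "\<forall>w\<in>carrier (matrix_grading_group n). \<psi> w \<in> carrier D"
    and w: "w \<in> carrier (matrix_grading_group n)" and v: "v \<in> carrier (matrix_grading_group n)"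
    and nonzero: "nonzero_mor covering (vertex w) (vertex v) A" and s: "s \<in> carrier D"
    and A: "A \<in> Y s (vertex w) (vertex v)"
  shows "s = \<psi> v \<otimes>\<^bsub>D\<^esub> inv\<^bsub>D\<^esub> (\<psi> w)"
proof -
  let ?d = "v \<otimes>\<^bsub>matrix_grading_group n\<^esub> inv\<^bsub>matrix_grading_group n\<^esub> w"
  have d: "?d \<in> carrier (matrix_grading_group n)" using w v by simp
  have AX: "A \<in> X ?d () ()" and Anz: "A \<noteq> 0\<^sub>m n n"
    using nonzero hom_vertex(1,2)[OF w v] by (auto simp: nonzero_mor_def)
  note A' = component_carrier[OF d AX]
  have "\<exists>a<n. \<exists>b<n. A $$ (a, b) \<noteq> 0"
  proof (rule ccontr)
    assume "\<not> ?thesis"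
    then have "A = 0\<^sub>m n n" using carrier_matD[OF A'] by (intro eq_matI) auto
    then show False using Anz by simp
  qed
  then obtain a b where ab: "a < n" "b < n" and nz: "A $$ (a, b) \<noteq> 0" by blast
  define i where "i = Suc b" define j where "j = Suc a"
  have ij: "i \<in> {1..n}" "j \<in> {1..n}" using ab by (auto simp: i_def j_def)
  define x where "x = A $$ (j - 1, i - 1)"
  have x: "x \<noteq> 0" using nz by (simp add: x_def i_def j_def)
  have "unit_degree n j i = ?d" using unit_degree_of_entry[OF d AX ij] x by (simp add: x_def)
  then have v_eq: "shift j i w = v" using w v by (simp add: F.m_assoc)
  have "matrix_unit n j j * (A * matrix_unit n i i) \<in>
      Y (\<one>\<^bsub>D\<^esub> \<otimes>\<^bsub>D\<^esub> (s \<otimes>\<^bsub>D\<^esub> \<one>\<^bsub>D\<^esub>)) (vertex w) (vertex v)"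
    by (rule smash_component_mult[OF w v v D.m_closed[OF s D.one_closed] D.one_closed
        smash_component_mult[OF w w v D.one_closed s diagonal_unit_degree[OF ij(1) w] A]
        diagonal_unit_degree[OF ij(2) v]])
  then have "x \<cdot>\<^sub>m matrix_unit n j i \<in> Y s (vertex w) (vertex v)"
    using s by (simp add: matrix_unit_compress[OF A' ij] x_def)
  then have "inverse x \<cdot>\<^sub>m (x \<cdot>\<^sub>m matrix_unit n j i) \<in> Y s (vertex w) (vertex v)"
    using subspace_smult[OF grading_subspace[OF Y vertex_Obj[OF w] vertex_Obj[OF v] s], of _ "inverse x"]
      hom_vertex(3)[OF w v] by simp
  moreover have "inverse x \<cdot>\<^sub>m (x \<cdot>\<^sub>m matrix_unit n j i) = matrix_unit n j i"
    using x by (intro eq_matI) auto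
  ultimately have "matrix_unit n j i \<in> Y s (vertex w) (vertex v)" by simp
  moreover have "matrix_unit n j i \<in> Y (\<psi> v \<otimes>\<^bsub>D\<^esub> inv\<^bsub>D\<^esub> (\<psi> w)) (vertex w) (vertex v)"
    using \<psi> ij w v_eq by metis
  moreover have "\<psi> v \<otimes>\<^bsub>D\<^esub> inv\<^bsub>D\<^esub> (\<psi> w) \<in> carrier D" using \<psi>_closed w v by simp
  moreover have "matrix_unit n j i \<noteq> \<zero>\<^bsub>Hom covering (vertex w) (vertex v)\<^esub>"
    by (simp only: hom_vertex(2)[OF w v] matrix_unit_nonzero[OF ij] not_False_eq_True)
  ultimately show ?thesis
    using grading_degree_unique[OF Y vertex_Obj[OF w] vertex_Obj[OF v] s] by blast
qed

end

lemma simply_connected_smash: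
  "simply_connected_kcat TYPE('d) (smash (matrix_kcat TYPE('k) n) (matrix_grading_group n) X)"
  unfolding simply_connected_kcat_def
proof (intro conjI allI impI)
  show "connected_kcat (smash (matrix_kcat TYPE('k) n) (matrix_grading_group n) X)"
    using connected_smash[OF connected_matrix_unit_grading] identity_in_component
    by (simp add: matrix_kcat_simps)
next
  fix D :: "'d monoid" and Y
  let ?S = "smash (matrix_kcat TYPE('k) n) (matrix_grading_group n) X"
  let ?inv = "\<lambda>w. inv\<^bsub>matrix_grading_group n\<^esub> w"
  assume con: "connected_grading D Y ?S"
  then have Y: "is_grading D Y ?S" by (simp add: connected_grading_def)
  obtain \<psi> where closed: "\<forall>w\<in>carrier (matrix_grading_group n). \<psi> w \<in> carrier D"
    and \<psi>: "\<forall>i\<in>{1..n}. \<forall>j\<in>{1..n}. \<forall>w\<in>carrier (matrix_grading_group n). matrix_unit n j i \<in>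
      Y (\<psi> (unit_degree n j i \<otimes>\<^bsub>matrix_grading_group n\<^esub> w) \<otimes>\<^bsub>D\<^esub> inv\<^bsub>D\<^esub> (\<psi> w))
        ((), ?inv w) ((), ?inv (unit_degree n j i \<otimes>\<^bsub>matrix_grading_group n\<^esub> w))"
    using smash_grading_potential[OF Y] by blast
  define \<phi> :: "unit \<times> (nat \<times> bool) list \<Rightarrow> 'd" where "\<phi> = (\<lambda>p. \<psi> (?inv (snd p)))"
  show "carrier D = {\<one>\<^bsub>D\<^esub>}"
  proof (rule connected_grading_trivial_if_potential[OF con])
    show "((), \<one>\<^bsub>matrix_grading_group n\<^esub>) \<in> Obj ?S" by (simp add: Obj_smash matrix_kcat_simps)
    show "\<phi> y \<in> carrier D" if "y \<in> Obj ?S" for y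
      using that closed by (auto simp: Obj_smash \<phi>_def)
    show "s = \<phi> z \<otimes>\<^bsub>D\<^esub> inv\<^bsub>D\<^esub> (\<phi> y)"
      if f: "nonzero_mor ?S y z f" "s \<in> carrier D" "f \<in> Y s y z" for y z f s
    proof -
      have g: "snd y \<in> carrier (matrix_grading_group n)" "snd z \<in> carrier (matrix_grading_group n)"
        using f(1) by (auto simp: nonzero_mor_def Obj_smash)
      then have "((), ?inv (?inv (snd y))) = y" "((), ?inv (?inv (snd z))) = z"
        by (simp_all add: prod_eq_iff)
      then show ?thesis
        using homogeneous_morphism_degree[OF Y \<psi> closed F.inv_closed[OF g(1)] F.inv_closed[OF g(2)], of f s] f
        by (simp add: \<phi>_def)
    qed
  qed
qed

end

theorem proposition4p11:
  fixes n :: nat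
  assumes "n \<ge> 1"
    and "\<exists>\<zeta> :: 'k::field. primitive_root_of_unity n \<zeta>"
  shows "(\<exists>X. is_matrix_unit_grading TYPE('k) n X) \<and>
    (\<forall>X. is_matrix_unit_grading TYPE('k) n X \<longrightarrow>
       connected_grading (matrix_grading_group n) X (matrix_kcat TYPE('k) n) \<and>
       simply_connected_grading TYPE('d) (matrix_grading_group n) X (matrix_kcat TYPE('k) n))"
  using matrix_unit_grading_exists[OF assms(1)] connected_matrix_unit_grading[OF assms(1)]
    simply_connected_smash[OF assms(1)]
  unfolding simply_connected_grading_def by blast

end
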